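(* Let $\mathcal{R}$ be any FS-RAM memory layout with $r$ registers of at most $b$ bits each and $B$ distinct FS-RAM bits, where $b\le w$ and $\log B\le w$. Let $A$ be any FS-RAM algorithm that uses the layout $\mathcal{R}$ and runs in time $T$. Then $A$ can be implemented in the UW-RAM so that it runs in time $O(T)$, using $rb+B$ additional words of (ordinary) RAM.
   Context: The word-RAM with word size $w$: memory consists of $w$-bit words holding integers in $\{0,\dots,2^w-1\}$, addressed by $w$-bit addresses; constant-time instructions are load/store/jump (with direct and indirect addressing), addition, subtraction, left/right shifts and bitwise AND/OR/NOT, arithmetic modulo $2^w$. The Ultra-Wide word-RAM (UW-RAM) extends the word-RAM by an additional ALU operating on wide words of $w^2$ bits, viewed as $w$ consecutive blocks $W_0,\dots,W_{w-1}$ of $w$ bits each ($W_j=W[jw..(j+1)w-1]$). In constant time the UW-RAM can: apply addition, subtraction, left/right shifts and bitwise boolean operations to whole wide words; apply compress (given $W$ whose only possibly set bits are the lowest bit of each block, produce $X$ with $X[j]=W_j[0]$ for $0\le j<w$ and all other bits $0$) and its inverse spread ($X_j[0]=W[j]$ for $0\le j<w$); and perform memory accesses (concurrent read, exclusive write): read/write one block from/to a memory word, read/write $w$ contiguous memory words into/from all blocks, and content access: for all $j$ in parallel, $W_j\leftarrow \mathrm{MEM}[\mathrm{base}+W_j]$, or for all $j$ in parallel, $\mathrm{MEM}[\mathrm{base}+V_j]\leftarrow W_j$ for a wide word $V$ of addresses. The ordinary $w$-bit ALU and $w$-bit addressing are retained. FS-RAM (Random Access Machine with byte overlap): memory consists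 of bits $\mathcal{B}_1,\dots,\mathcal{B}_B$ and registers, each register being a sequence of at most $b$ of these bits, where a single bit may belong to several registers; the layout $\mathcal{R}$ specifies for each register $i$ and position $j$ the index $k$ with reg$[i]$.bit$[j]=\mathcal{B}_k$. An FS-RAM algorithm reads/writes whole registers in constant time in addition to ordinary RAM operations.
   Formalization: Assumes the RAM of A plus the rb+B additional words fits in the 2^w addressable words (else these words do not exist); the table of the layout in the additional words and O(1) constant wide words are present at the start, so their set-up is not counted in O(T). *)

theory Defs
  imports Complex_Main
begin

section \<open>Words and blocks\<close>

text \<open>
  An \<open>n\<close>-bit word is a natural number below \<open>2 ^ n\<close>; bit \<open>i\<close> is the coefficient of \<open>2 ^ i\<close>.
  The same ALU is used with \<open>n = w\<close> (ordinary words) and \<open>n = w * w\<close> (wide words).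
\<close>

datatype alu_op = Add | Sub | ShiftL | ShiftR | BitAnd | BitOr

fun alu :: "nat \<Rightarrow> alu_op \<Rightarrow> nat \<Rightarrow> nat \<Rightarrow> nat" where
  "alu n Add x y = take_bit n (x + y)"
| "alu n Sub x y = take_bit n (x + (2 ^ n - y))"
| "alu n ShiftL x y = take_bit n (push_bit y x)"
| "alu n ShiftR x y = drop_bit y x"
| "alu n BitAnd x y = Bit_Operations.and x y"
| "alu n BitOr x y = Bit_Operations.or x y"

definition complement :: "nat \<Rightarrow> nat \<Rightarrow> nat" where
  "complement n x = Bit_Operations.xor (mask n) x"

definition block :: "nat \<Rightarrow> nat \<Rightarrow> nat \<Rightarrow> nat" where
  "block w X j = take_bit w (drop_bit (j * w) X)"

definition of_blocks :: "nat \<Rightarrow> (nat \<Rightarrow> nat) \<Rightarrow> nat" where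
  "of_blocks w f = horner_sum id (2 ^ w) (map f [0..<w])"

definition compress :: "nat \<Rightarrow> nat \<Rightarrow> nat" where
  "compress w X = horner_sum of_bool 2 (map (\<lambda>j. bit (block w X j) 0) [0..<w])"

definition spread :: "nat \<Rightarrow> nat \<Rightarrow> nat" where
  "spread w X = of_blocks w (\<lambda>j. of_bool (bit X j))"


section \<open>The word-RAM\<close>

text \<open>
  Programs use finitely many CPU registers, whose names have type \<open>'r\<close> (instantiated to
  \<^typ>\<open>nat\<close>), so that the generated set function of an instruction type yields the registers
  occurring in an instruction. \<open>Direct a\<close> denotes the constant \<open>a\<close>, and \<open>Indirect x\<close> the
  contents of CPU register \<open>x\<close>; as an operand of a memory access or jump it is the address
  or target.
\<close>

datatype 'r operand = Direct nat | Indirect 'r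

datatype 'r word_instr =
    Const 'r nat
  | Load 'r "'r operand"
  | Store "'r operand" 'r
  | Alu alu_op 'r 'r 'r
  | BitNot 'r 'r
  | Jump "'r operand"
  | JumpIfZero 'r "'r operand"
  | Halt

record word_state =
  pc :: nat
  reg :: "nat \<Rightarrow> nat"
  mem :: "nat \<Rightarrow> nat"

fun operand_val :: "'a word_state_scheme \<Rightarrow> nat operand \<Rightarrow> nat" where
  "operand_val s (Direct a) = a"
| "operand_val s (Indirect x) = reg s x"

definition advance :: "'a word_state_scheme \<Rightarrow> 'a word_state_scheme" where
  "advance s = s\<lparr>pc := Suc (pc s)\<rparr>"

definition set_reg :: "nat \<Rightarrow> nat \<Rightarrow> 'a word_state_scheme \<Rightarrow> 'a word_state_scheme" where
  "set_reg x v s = s\<lparr>reg := (reg s)(x := v)\<rparr>"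

definition set_mem :: "nat \<Rightarrow> nat \<Rightarrow> 'a word_state_scheme \<Rightarrow> 'a word_state_scheme" where
  "set_mem a v s = s\<lparr>mem := (mem s)(a := v)\<rparr>"

text \<open>
  One ordinary instruction with words of \<open>w\<close> bits and a memory with addresses below \<open>N\<close>.
  \<^term>\<open>None\<close> means that the machine has no next state, because it has halted or because
  the instruction is undefined (here: an access outside the memory).
\<close>

fun word_step :: "nat \<Rightarrow> nat \<Rightarrow> nat word_instr \<Rightarrow> 'a word_state_scheme \<Rightarrow> 'a word_state_scheme option"
where
  "word_step w N (Const x v) s = Some (advance (set_reg x (take_bit w v) s))"
| "word_step w N (Load x a) s =
     (let a' = operand_val s a in
      if a' < N then Some (advance (set_reg x (mem s a') s)) else None)"
| "word_step w N (Store a x) s =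
     (let a' = operand_val s a in
      if a' < N then Some (advance (set_mem a' (reg s x) s)) else None)"
| "word_step w N (Alu f x y z) s = Some (advance (set_reg x (alu w f (reg s y) (reg s z)) s))"
| "word_step w N (BitNot x y) s = Some (advance (set_reg x (complement w (reg s y)) s))"
| "word_step w N (Jump l) s = Some (s\<lparr>pc := operand_val s l\<rparr>)"
| "word_step w N (JumpIfZero x l) s =
     Some (if reg s x = 0 then s\<lparr>pc := operand_val s l\<rparr> else advance s)"
| "word_step w N Halt s = None"

definition steps :: "('s \<Rightarrow> 's option) \<Rightarrow> nat \<Rightarrow> 's \<Rightarrow> 's option" where
  "steps f n s = ((\<lambda>x. Option.bind x f) ^^ n) (Some s)"


section \<open>The FS-RAM\<close>

text \<open>
  A layout maps each register \<open>i < r\<close> to the list of the indices of its bits; bits are numbered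
  from \<open>0\<close>. A bit may occur in several registers, and even several times in one register.
\<close>

type_synonym layout = "nat \<Rightarrow> nat list"

definition fs_layout :: "nat \<Rightarrow> nat \<Rightarrow> nat \<Rightarrow> layout \<Rightarrow> bool" where
  "fs_layout r b B R \<longleftrightarrow> (\<forall>i<r. length (R i) \<le> b \<and> set (R i) \<subseteq> {..<B})"

datatype 'r fs_instr =
    FS_Ordinary "'r word_instr"
  | FS_Read 'r "'r operand"
  | FS_Write "'r operand" 'r

record fs_state = word_state +
  fs_bit :: "nat \<Rightarrow> bool"

text \<open>
  Writing \<open>v\<close> to FS-RAM register \<open>i\<close> sets its bit in position \<open>j\<close> to bit \<open>j\<close> of \<open>v\<close>; the bits
  of \<open>v\<close> beyond the length of the register are ignored. The write is undefined if it would
  assign two different values to one FS-RAM bit; this cannot happen if the entries of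
  \<open>R i\<close> are distinct.
\<close>

definition write_consistent :: "nat list \<Rightarrow> nat \<Rightarrow> bool" where
  "write_consistent ks v \<longleftrightarrow>
     (\<forall>j<length ks. \<forall>j'<length ks. ks ! j = ks ! j' \<longrightarrow> bit v j = bit v j')"

definition write_bits :: "nat list \<Rightarrow> nat \<Rightarrow> (nat \<Rightarrow> bool) \<Rightarrow> nat \<Rightarrow> bool" where
  "write_bits ks v \<beta> k =
     (if k \<in> set ks then \<exists>j<length ks. ks ! j = k \<and> bit v j else \<beta> k)"

definition read_bits :: "nat list \<Rightarrow> (nat \<Rightarrow> bool) \<Rightarrow> nat" where
  "read_bits ks \<beta> = horner_sum of_bool 2 (map \<beta> ks)"

fun fs_exec :: "nat \<Rightarrow> nat \<Rightarrow> nat \<Rightarrow> layout \<Rightarrow> nat fs_instr \<Rightarrow> fs_state \<Rightarrow> fs_state option" where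
  "fs_exec w M r R (FS_Ordinary I) s = word_step w M I s"
| "fs_exec w M r R (FS_Read x i) s =
     (let i' = operand_val s i in
      if i' < r then Some (advance (set_reg x (read_bits (R i') (fs_bit s)) s)) else None)"
| "fs_exec w M r R (FS_Write i x) s =
     (let i' = operand_val s i; v = reg s x in
      if i' < r \<and> write_consistent (R i') v
      then Some (advance (s\<lparr>fs_bit := write_bits (R i') v (fs_bit s)\<rparr>)) else None)"

text \<open>\<open>M\<close> is the number of words of ordinary RAM.\<close>

definition fs_step ::
  "nat \<Rightarrow> nat \<Rightarrow> nat \<Rightarrow> layout \<Rightarrow> nat fs_instr list \<Rightarrow> fs_state \<Rightarrow> fs_state option" where
  "fs_step w M r R A s = (if pc s < length A then fs_exec w M r R (A ! pc s) s else None)"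

definition fs_run ::
  "nat \<Rightarrow> nat \<Rightarrow> nat \<Rightarrow> layout \<Rightarrow> nat fs_instr list \<Rightarrow> nat \<Rightarrow> fs_state \<Rightarrow> fs_state \<Rightarrow> bool" where
  "fs_run w M r R A T s s' \<longleftrightarrow>
     steps (fs_step w M r R A) T s = Some s' \<and>
     pc s' < length A \<and> A ! pc s' = FS_Ordinary Halt"

definition fs_valid :: "nat \<Rightarrow> nat \<Rightarrow> fs_state \<Rightarrow> bool" where
  "fs_valid w M s \<longleftrightarrow> (\<forall>x. reg s x < 2 ^ w) \<and> (\<forall>a<M. mem s a < 2 ^ w)"

text \<open>\<open>K\<close> bounds the CPU registers used by the program.\<close>

definition fs_program :: "nat \<Rightarrow> nat fs_instr list \<Rightarrow> bool" where
  "fs_program K A \<longleftrightarrow> (\<forall>I\<in>set A. set_fs_instr I \<subseteq> {..<K})"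


section \<open>The UW-RAM\<close>

text \<open>
  \<open>'x\<close> is the type of names of wide registers. In the block instructions the operand of type
  \<open>'r operand\<close> next to \<open>'x\<close> is the block index, the other one the memory address. In the
  instructions on contiguous words and in the content accesses it is the base address.
  In \<open>WriteContent b V W\<close>, \<open>V\<close> holds the addresses and \<open>W\<close> the data.
\<close>

datatype ('r, 'x) uw_instr =
    UW_Ordinary "'r word_instr"
  | WideAlu alu_op 'x 'x 'x
  | WideNot 'x 'x
  | Compress 'x 'x
  | Spread 'x 'x
  | ReadBlock 'x "'r operand" "'r operand"
  | WriteBlock "'r operand" 'x "'r operand"
  | ReadWords 'x "'r operand"
  | WriteWords "'r operand" 'x
  | ReadContent 'x "'r operand"
  | WriteContent "'r operand" 'x 'x

record uw_state = word_state +
  wide :: "nat \<Rightarrow> nat"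

definition set_wide :: "nat \<Rightarrow> nat \<Rightarrow> uw_state \<Rightarrow> uw_state" where
  "set_wide x W s = s\<lparr>wide := (wide s)(x := W)\<rparr>"

definition gather :: "nat \<Rightarrow> (nat \<Rightarrow> nat) \<Rightarrow> uw_state \<Rightarrow> nat" where
  "gather w adr s = of_blocks w (\<lambda>j. mem s (adr j))"

text \<open>Exclusive write: the simultaneous write is undefined if two blocks share an address.\<close>

definition scatter :: "nat \<Rightarrow> (nat \<Rightarrow> nat) \<Rightarrow> nat \<Rightarrow> uw_state \<Rightarrow> uw_state option" where
  "scatter w adr W s =
     (if inj_on adr {..<w}
      then Some (s\<lparr>mem := (\<lambda>a. if a \<in> adr ` {..<w}
                              then block w W (inv_into {..<w} adr a) else mem s a)\<rparr>)
      else None)"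

fun uw_exec :: "nat \<Rightarrow> (nat, nat) uw_instr \<Rightarrow> uw_state \<Rightarrow> uw_state option" where
  "uw_exec w (UW_Ordinary I) s = word_step w (2 ^ w) I s"
| "uw_exec w (WideAlu f x y z) s =
     Some (advance (set_wide x (alu (w * w) f (wide s y) (wide s z)) s))"
| "uw_exec w (WideNot x y) s = Some (advance (set_wide x (complement (w * w) (wide s y)) s))"
| "uw_exec w (Compress x y) s =
     (if \<forall>n. bit (wide s y) n \<longrightarrow> w dvd n
      then Some (advance (set_wide x (compress w (wide s y)) s)) else None)"
| "uw_exec w (Spread x y) s =
     (if wide s y < 2 ^ w
      then Some (advance (set_wide x (spread w (wide s y)) s)) else None)"
| "uw_exec w (ReadBlock x j a) s =
     (let j' = operand_val s j; a' = operand_val s a in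
      if j' < w \<and> a' < 2 ^ w
      then Some (advance (set_wide x (of_blocks w ((block w (wide s x))(j' := mem s a'))) s))
      else None)"
| "uw_exec w (WriteBlock a x j) s =
     (let j' = operand_val s j; a' = operand_val s a in
      if j' < w \<and> a' < 2 ^ w
      then Some (advance (set_mem a' (block w (wide s x) j') s))
      else None)"
| "uw_exec w (ReadWords x b) s =
     Some (advance (set_wide x (gather w (\<lambda>j. (operand_val s b + j) mod 2 ^ w) s) s))"
| "uw_exec w (WriteWords b x) s =
     map_option advance (scatter w (\<lambda>j. (operand_val s b + j) mod 2 ^ w) (wide s x) s)"
| "uw_exec w (ReadContent x b) s =
     Some (advance (set_wide x
       (gather w (\<lambda>j. (operand_val s b + block w (wide s x) j) mod 2 ^ w) s) s))"
| "uw_exec w (WriteContent b y x) s =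
     map_option advance
       (scatter w (\<lambda>j. (operand_val s b + block w (wide s y) j) mod 2 ^ w) (wide s x) s)"

definition uw_step :: "nat \<Rightarrow> (nat, nat) uw_instr list \<Rightarrow> uw_state \<Rightarrow> uw_state option" where
  "uw_step w P u = (if pc u < length P then uw_exec w (P ! pc u) u else None)"

definition uw_run ::
  "nat \<Rightarrow> (nat, nat) uw_instr list \<Rightarrow> nat \<Rightarrow> uw_state \<Rightarrow> uw_state \<Rightarrow> bool" where
  "uw_run w P T u u' \<longleftrightarrow>
     steps (uw_step w P) T u = Some u' \<and>
     pc u' < length P \<and> P ! pc u' = UW_Ordinary Halt"

definition uw_valid :: "nat \<Rightarrow> uw_state \<Rightarrow> bool" where
  "uw_valid w u \<longleftrightarrow>
     (\<forall>x. reg u x < 2 ^ w) \<and> (\<forall>a<2 ^ w. mem u a < 2 ^ w) \<and> (\<forall>x. wide u x < 2 ^ (w * w))"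

definition uw_program :: "nat \<Rightarrow> nat \<Rightarrow> (nat, nat) uw_instr list \<Rightarrow> bool" where
  "uw_program K c P \<longleftrightarrow> (\<forall>I\<in>set P. set1_uw_instr I \<subseteq> {..<K} \<and> set2_uw_instr I \<subseteq> {..<c})"

text \<open>Words outside \<open>S\<close> never change in the first \<open>T\<close> steps.\<close>

definition uw_writes_within ::
  "nat \<Rightarrow> (nat, nat) uw_instr list \<Rightarrow> nat \<Rightarrow> uw_state \<Rightarrow> nat set \<Rightarrow> bool" where
  "uw_writes_within w P T u S \<longleftrightarrow>
     (\<forall>t\<le>T. \<forall>v. steps (uw_step w P) t u = Some v \<longrightarrow>
       (\<forall>a<2 ^ w. a \<notin> S \<longrightarrow> mem v a = mem u a))"


section \<open>Implementing FS-RAM algorithms in the UW-RAM\<close>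

text \<open>
  \<open>enc \<beta> 0, \<dots>, enc \<beta> (n - 1)\<close> are the contents of the \<open>n\<close> additional words representing
  the values \<open>\<beta>\<close> of the \<open>B\<close> FS-RAM bits; they may also hold static data such as a table of the
  layout. The equivalence says that they determine these values and depend on nothing else.
  The constants \<open>wc\<close> are the static contents of \<open>c\<close> wide registers, for example masks.
\<close>

definition encoding ::
  "nat \<Rightarrow> nat \<Rightarrow> nat \<Rightarrow> nat \<Rightarrow> ((nat \<Rightarrow> bool) \<Rightarrow> nat \<Rightarrow> nat) \<Rightarrow> (nat \<Rightarrow> nat) \<Rightarrow> bool" where
  "encoding w n B c enc wc \<longleftrightarrow>
     (\<forall>\<beta>. \<forall>k<n. enc \<beta> k < 2 ^ w) \<and>
     (\<forall>\<beta> \<beta>'. (\<forall>k<n. enc \<beta> k = enc \<beta>' k) \<longleftrightarrow> (\<forall>k<B. \<beta> k = \<beta>' k)) \<and>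
     (\<forall>x<c. wc x < 2 ^ (w * w))"

text \<open>
  The \<open>M\<close> words of RAM of the FS-RAM occupy the same addresses in the UW-RAM, followed by the
  \<open>n\<close> additional words.
\<close>

definition represents ::
  "nat \<Rightarrow> nat \<Rightarrow> nat \<Rightarrow> nat \<Rightarrow> ((nat \<Rightarrow> bool) \<Rightarrow> nat \<Rightarrow> nat) \<Rightarrow> (nat \<Rightarrow> nat) \<Rightarrow>
   fs_state \<Rightarrow> uw_state \<Rightarrow> bool" where
  "represents K M n c enc wc s u \<longleftrightarrow>
     (\<forall>x<K. reg u x = reg s x) \<and>
     (\<forall>a<M. mem u a = mem s a) \<and>
     (\<forall>k<n. mem u (M + k) = enc (fs_bit s) k) \<and>
     (\<forall>x<c. wide u x = wc x)"

text \<open>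
  Whenever \<open>A\<close> halts after \<open>T\<close> steps, \<open>P\<close> halts after at most \<open>c * T\<close> steps in a state that
  represents the final state of \<open>A\<close>. All contents of the UW-RAM not mentioned in
  \<^const>\<open>represents\<close> are arbitrary, and the memory outside the first \<open>M + n\<close> words
  is never changed.
\<close>

definition implements ::
  "nat \<Rightarrow> nat \<Rightarrow> layout \<Rightarrow> nat \<Rightarrow> nat \<Rightarrow> nat \<Rightarrow> nat \<Rightarrow>
   ((nat \<Rightarrow> bool) \<Rightarrow> nat \<Rightarrow> nat) \<Rightarrow> (nat \<Rightarrow> nat) \<Rightarrow>
   nat fs_instr list \<Rightarrow> (nat, nat) uw_instr list \<Rightarrow> bool" where
  "implements w r R K M n c enc wc A P \<longleftrightarrow>
     (\<forall>s s' T u. fs_valid w M s \<longrightarrow> pc s = 0 \<longrightarrow> fs_run w M r R A T s s' \<longrightarrow>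
        uw_valid w u \<longrightarrow> pc u = 0 \<longrightarrow> represents K M n c enc wc s u \<longrightarrow>
        (\<exists>u' T'. T' \<le> c * T \<and> uw_run w P T' u u' \<and>
           represents K M n c enc wc s' u' \<and> uw_writes_within w P T' u {..<M + n}))"

end

theory Submission
  imports Defs
begin

text \<open>
  Each FS-RAM bit gets a word of its own, and \<open>r * b\<close> further words hold, for every position of
  every register, a pointer to its bit. A register is then accessed by two nested content
  accesses: one fetches its column of the pointer table, the other the bits themselves;
  \<open>compress\<close> and \<open>spread\<close> convert between lanes and a single word. Writes are exclusive, so only
  the first occurrence of a bit in a register may be written, and the remaining lanes have to be
  sent to distinct harmless addresses. This takes two rounds: the upper half of the address
  space supplies the dummy addresses while the lower half is written, and conversely.
\<close>

section \<open>Wide words as vectors of lanes\<close>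

text \<open>Three restrictions shape the construction. There is no multiplication, so the table is
  stored by positions: position j of register i has offset j * r + i, the vector of the numbers j *
  r is the same for all i, and the base \<open>M + i\<close> does the rest. Table and bit cells may
  fill the whole address space, so neither an entry nor a lane has a spare bit. Lane comparisons
  must therefore work on full w-bit values, which are split into the top bit and the remaining bits.
  Finally, a lane with nothing to write still takes part in a content write. It returns the word
  just read at its dummy address, so a dummy may be any address, even one in use, but it must differ
  from all other addresses of the same write. The bit cells of a register can lie anywhere, so no
  fixed choice of dummies is safe for all layouts at once; separating the targets by the top bit of
  their offset makes a fixed choice safe in each round. Memory is also the only passage between
  ordinary and wide registers, so a scratch word is borrowed at \<open>M\<close> and restored. Such
  a word need not exist if there are no bits at all, which makes degenerate layouts a separate
  case.\<close>

lemma bit_horner_sum_blocks: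
  assumes "0 < w" "\<forall>x\<in>set xs. x < 2 ^ w"
  shows "bit (horner_sum id (2 ^ w) xs :: nat) n \<longleftrightarrow>
    n < w * length xs \<and> bit (xs ! (n div w)) (n mod w)"
  using assms(2)
proof (induction xs arbitrary: n)
  case Nil
  then show ?case by simp
next
  case (Cons x xs)
  let ?h = "horner_sum id (2 ^ w) xs :: nat"
  have x: "\<not> bit x m" if "w \<le> m" for m
    using that Cons.prems by (metis bit_take_bit_iff linorder_not_le list.set_intros(1) take_bit_nat_eq_self)
  \<comment> \<open>The summands share no bit: x lies below position w and the shifted tail from w
    on, so the addition is carry-free.\<close>
  have "x + push_bit w ?h = Bit_Operations.or x (push_bit w ?h)"
    by (rule disjunctive_add_eq_or) (auto simp: bit_eq_iff bit_simps dest: x)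
  then have *: "bit (horner_sum id (2 ^ w) (x # xs)) n \<longleftrightarrow> bit x n \<or> w \<le> n \<and> bit ?h (n - w)"
  proof -
    have "horner_sum id (2 ^ w) (x # xs) = x + push_bit w ?h"
      by (simp add: push_bit_eq_mult mult.commute)
    then show ?thesis by (simp add: \<open>x + push_bit w ?h = _\<close> bit_or_iff bit_push_bit_iff del: horner_sum_simps)
  qed
  show ?case
  proof (cases "n < w")
    case True
    then show ?thesis unfolding * by simp
  next
    case False
    then have "\<not> bit x n" by (simp add: x)
    moreover have "n div w = Suc ((n - w) div w)" "n mod w = (n - w) mod w"
      using False assms(1) by (auto simp: le_div_geq le_mod_geq)
    moreover have "bit ?h (n - w) \<longleftrightarrow>
        n - w < w * length xs \<and> bit (xs ! ((n - w) div w)) ((n - w) mod w)"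
      by (rule Cons.IH) (use Cons.prems in auto)
    ultimately show ?thesis unfolding * using False by (auto simp: less_diff_conv2)
  qed
qed

text \<open>A relation, so that the contents of a wide register are described by one formula per
  lane and each wide instruction becomes a rule on such formulas. The bound is included because it
  is what keeps neighbouring lanes apart.\<close>

definition lanes :: "nat \<Rightarrow> nat \<Rightarrow> (nat \<Rightarrow> nat) \<Rightarrow> bool" where
  "lanes w X f \<longleftrightarrow> X = of_blocks w f \<and> (\<forall>j<w. f j < 2 ^ w)"

lemma of_blocks_eq_sum: "of_blocks w f = (\<Sum>j<w. f j * 2 ^ (w * j))"
  by (simp add: of_blocks_def horner_sum_eq_sum power_mult atLeast0LessThan)

lemma lanes_of_blocks: "(\<And>j. j < w \<Longrightarrow> f j < 2 ^ w) \<Longrightarrow> lanes w (of_blocks w f) f"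
  by (simp add: lanes_def)

lemma lanes_lane_less: "lanes w X f \<Longrightarrow> j < w \<Longrightarrow> f j < 2 ^ w"
  by (simp add: lanes_def)

lemma lanes_cong: "lanes w X f \<Longrightarrow> (\<And>j. j < w \<Longrightarrow> f j = g j) \<Longrightarrow> lanes w X g"
  by (simp add: lanes_def of_blocks_eq_sum)

lemma lanes_bit:
  assumes "lanes w X f" "0 < w"
  shows "bit X n \<longleftrightarrow> n < w * w \<and> bit (f (n div w)) (n mod w)"
  using assms bit_horner_sum_blocks[of w "map f [0..<w]" n]
  by (auto simp: lanes_def of_blocks_def less_mult_imp_div_less)

lemma nat_less_exp_if_bits: "(x::nat) < 2 ^ n" if "\<And>m. bit x m \<Longrightarrow> m < n"
proof -
  have "take_bit n x = x" by (rule bit_eqI) (auto simp: bit_take_bit_iff dest: that)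
  then show ?thesis by (simp add: take_bit_nat_eq_self_iff)
qed

lemma not_bit_if_less_exp: "(x::nat) < 2 ^ n \<Longrightarrow> n \<le> m \<Longrightarrow> \<not> bit x m"
  by (metis bit_take_bit_iff linorder_not_le take_bit_nat_eq_self)

lemma bit_less_exp_index: "(x::nat) < 2 ^ n \<Longrightarrow> bit x m \<Longrightarrow> m < n"
  using not_bit_if_less_exp linorder_not_le by blast

lemma lanes_less:
  assumes "lanes w X f"
  shows "X < 2 ^ (w * w)"
proof (cases "w = 0")
  case True
  then show ?thesis using assms by (simp add: lanes_def of_blocks_def)
next
  case False
  then show ?thesis using lanes_bit[OF assms] by (auto intro: nat_less_exp_if_bits)
qed

lemma lane_index_less: "j < w \<Longrightarrow> i < w \<Longrightarrow> j * w + i < w * (w::nat)"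
proof -
  assume "j < w" "i < w"
  then have "j * w + i < Suc j * w" by simp
  also have "\<dots> \<le> w * w" using \<open>j < w\<close> by (intro mult_right_mono) auto
  finally show ?thesis .
qed

lemma lanes_block:
  assumes "lanes w X f" "j < w"
  shows "block w X j = f j"
proof (rule bit_eqI)
  fix i
  have "bit (block w X j) i \<longleftrightarrow> i < w \<and> bit X (j * w + i)"
    by (simp add: block_def bit_simps)
  also have "\<dots> \<longleftrightarrow> i < w \<and> bit (f j) i"
  proof (cases "i < w")
    case True
    then have "(j * w + i) div w = j" "(j * w + i) mod w = i" "0 < w" by simp_all
    then show ?thesis
      using lanes_bit[OF assms(1) \<open>0 < w\<close>, of "j * w + i"] lane_index_less[OF assms(2) True] by simp
  qed simp
  also have "\<dots> \<longleftrightarrow> bit (f j) i"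
    using bit_less_exp_index[OF lanes_lane_less[OF assms]] by blast
  finally show "bit (block w X j) i \<longleftrightarrow> bit (f j) i" .
qed

lemma lanesI_bit:
  assumes "0 < w" "\<And>j. j < w \<Longrightarrow> f j < 2 ^ w"
    and "\<And>n. bit X n \<longleftrightarrow> n < w * w \<and> bit (f (n div w)) (n mod w)"
  shows "lanes w X f"
proof -
  have "X = of_blocks w f"
    by (rule bit_eqI) (simp add: assms(3) lanes_bit[OF lanes_of_blocks assms(1)] assms(2))
  then show ?thesis using assms(2) by (simp add: lanes_def)
qed

lemma lanes_and:
  assumes "0 < w" "lanes w X f" "lanes w Y g"
  shows "lanes w (alu (w * w) BitAnd X Y) (\<lambda>j. Bit_Operations.and (f j) (g j))"
proof (rule lanesI_bit[OF assms(1)])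
  show "Bit_Operations.and (f j) (g j) < 2 ^ w" if "j < w" for j
    using bit_less_exp_index[OF lanes_lane_less[OF assms(2) that]]
    by (intro nat_less_exp_if_bits) (auto simp: bit_and_iff)
qed (auto simp: lanes_bit[OF assms(2,1)] lanes_bit[OF assms(3,1)] bit_and_iff)

lemma lanes_or:
  assumes "0 < w" "lanes w X f" "lanes w Y g"
  shows "lanes w (alu (w * w) BitOr X Y) (\<lambda>j. Bit_Operations.or (f j) (g j))"
proof (rule lanesI_bit[OF assms(1)])
  show "Bit_Operations.or (f j) (g j) < 2 ^ w" if "j < w" for j
    using bit_less_exp_index[OF lanes_lane_less[OF assms(2) that]]
      bit_less_exp_index[OF lanes_lane_less[OF assms(3) that]]
    by (intro nat_less_exp_if_bits) (auto simp: bit_or_iff)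
qed (auto simp: lanes_bit[OF assms(2,1)] lanes_bit[OF assms(3,1)] bit_or_iff)

lemma lanes_not:
  assumes "0 < w" "lanes w X f"
  shows "lanes w (complement (w * w) X) (\<lambda>j. complement w (f j))"
proof (rule lanesI_bit[OF assms(1)])
  show "complement w (f j) < 2 ^ w" if "j < w" for j
    using bit_less_exp_index[OF lanes_lane_less[OF assms(2) that]]
    by (intro nat_less_exp_if_bits) (auto simp: complement_def bit_simps)
qed (use assms(1) in \<open>auto simp: lanes_bit[OF assms(2,1)] complement_def bit_simps\<close>)

text \<open>No carry crosses a lane boundary when every lane sum fits; on the weighted sum of the
  lanes the claim is distributivity.\<close>

lemma lanes_add:
  assumes "lanes w X f" "lanes w Y g" "\<And>j. j < w \<Longrightarrow> f j + g j < 2 ^ w"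
  shows "lanes w (alu (w * w) Add X Y) (\<lambda>j. f j + g j)"
proof -
  have L: "lanes w (of_blocks w (\<lambda>j. f j + g j)) (\<lambda>j. f j + g j)"
    using assms(3) by (rule lanes_of_blocks)
  have "X + Y = of_blocks w (\<lambda>j. f j + g j)"
    using assms by (simp add: lanes_def of_blocks_eq_sum sum.distrib add_mult_distrib)
  then show ?thesis using L lanes_less[OF L] by (simp add: take_bit_nat_eq_self)
qed

text \<open>Without a borrow in any lane, adding Y to the lanewise difference gives back X. As the
  ALU adds \<open>2 ^ (w * w) - Y\<close>, the result is the difference plus exactly one modulus,
  which the truncation removes.\<close>

lemma lanes_sub:
  assumes "lanes w X f" "lanes w Y g" "\<And>j. j < w \<Longrightarrow> g j \<le> f j"
  shows "lanes w (alu (w * w) Sub X Y) (\<lambda>j. f j - g j)"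
proof -
  have L: "lanes w (of_blocks w (\<lambda>j. f j - g j)) (\<lambda>j. f j - g j)"
    using lanes_lane_less[OF assms(1)] by (intro lanes_of_blocks) (meson diff_le_self le_less_trans)
  have "of_blocks w (\<lambda>j. f j - g j) + Y = X"
    using assms by (simp add: lanes_def of_blocks_eq_sum flip: sum.distrib add_mult_distrib)
  then have "X + (2 ^ (w * w) - Y) = of_blocks w (\<lambda>j. f j - g j) + 2 ^ (w * w)"
    using lanes_less[OF assms(2)] by simp
  then show ?thesis using L lanes_less[OF L] by (simp add: take_bit_eq_mod)
qed

text \<open>A shift of the wide word pushes the low bits of a lane into the lane below. Divisibility
  of every lane by \<open>2 ^ k\<close> says that these bits are zero.\<close>

lemma lanes_shift_right:
  assumes "lanes w X (\<lambda>j. 2 ^ k * f j)"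
  shows "lanes w (alu (w * w) ShiftR X k) f"
proof -
  have "X = 2 ^ k * of_blocks w f"
    using assms by (simp add: lanes_def of_blocks_eq_sum sum_distrib_left mult.assoc)
  moreover have "f j < 2 ^ w" if "j < w" for j
  proof -
    have "f j \<le> 2 ^ k * f j" by simp
    then show ?thesis using lanes_lane_less[OF assms that] by (rule le_less_trans)
  qed
  ultimately show ?thesis by (simp add: lanes_def drop_bit_eq_div)
qed

definition lane_mask :: "nat \<Rightarrow> (nat \<Rightarrow> bool) \<Rightarrow> nat \<Rightarrow> nat" where
  "lane_mask w p j = (if p j then mask w else 0)"

lemma lanes_select:
  assumes "0 < w" "lanes w X f" "lanes w P (lane_mask w p)"
  shows "lanes w (alu (w * w) BitAnd X P) (\<lambda>j. if p j then f j else 0)"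
  by (rule lanes_cong[OF lanes_and[OF assms]])
     (use lanes_lane_less[OF assms(2)] in \<open>simp add: lane_mask_def take_bit_nat_eq_self flip: take_bit_eq_mask\<close>)

lemma lanes_mask_not:
  assumes "0 < w" "lanes w P (lane_mask w p)"
  shows "lanes w (complement (w * w) P) (lane_mask w (\<lambda>j. \<not> p j))"
  by (rule lanes_cong[OF lanes_not[OF assms]]) (simp add: lane_mask_def complement_def)

lemma lanes_mask_and:
  assumes "0 < w" "lanes w P (lane_mask w p)" "lanes w Q (lane_mask w q)"
  shows "lanes w (alu (w * w) BitAnd P Q) (lane_mask w (\<lambda>j. p j \<and> q j))"
  by (rule lanes_cong[OF lanes_and[OF assms]]) (simp add: lane_mask_def)

lemma lanes_merge:
  assumes "0 < w" "lanes w X (\<lambda>j. if p j then f j else 0)"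
    and "lanes w Y (\<lambda>j. if \<not> p j then g j else 0)"
  shows "lanes w (alu (w * w) BitOr X Y) (\<lambda>j. if p j then f j else g j)"
  by (rule lanes_cong[OF lanes_or[OF assms]]) simp

lemma lanes_copy:
  assumes "0 < w" "lanes w X f" "lanes w Z (\<lambda>_. 0)"
  shows "lanes w (alu (w * w) BitOr X Z) f"
  by (rule lanes_cong[OF lanes_or[OF assms]]) simp

text \<open>Smears the top bit over its lane. With h = 2 ^ (w - 1), a marked lane becomes h + (h -
  1) = 2 ^ w - 1, where h - 1 arises by subtracting the top bit moved to position 0; an unmarked
  lane stays 0.\<close>

lemma lanes_full_mask:
  assumes "0 < w" "lanes w X (\<lambda>j. 2 ^ (w - 1) * of_bool (p j))"
  defines "Y \<equiv> alu (w * w) Sub X (alu (w * w) ShiftR X (w - 1))"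
  shows "lanes w (alu (w * w) Add X Y) (lane_mask w p)"
proof -
  have Y: "lanes w Y (\<lambda>j. 2 ^ (w - 1) * of_bool (p j) - of_bool (p j))"
    unfolding Y_def using assms by (intro lanes_sub lanes_shift_right) auto
  have w: "(2::nat) ^ w = 2 ^ (w - 1) + 2 ^ (w - 1)"
    using assms(1) by (cases w) auto
  have pos: "(0::nat) < 2 ^ (w - 1)" by simp
  have "lanes w (alu (w * w) Add X Y)
          (\<lambda>j. 2 ^ (w - 1) * of_bool (p j) + (2 ^ (w - 1) * of_bool (p j) - of_bool (p j)))"
    by (rule lanes_add[OF assms(2) Y]) (use w pos in auto)
  then show ?thesis
    by (rule lanes_cong) (use w pos in \<open>auto simp: lane_mask_def mask_eq_exp_minus_1\<close>)
qed

section \<open>Comparison of all lanes with a constant\<close>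

lemma and_exp_eq_of_bool: "Bit_Operations.and x (2 ^ k) = 2 ^ k * of_bool (bit (x::nat) k)"
  by (rule bit_eqI) (auto simp: bit_and_iff bit_exp_iff)

lemma bit_top_iff: "bit x (w - 1) \<longleftrightarrow> 2 ^ (w - 1) \<le> x" if "0 < w" "(x::nat) < 2 ^ w"
proof -
  have "x div 2 ^ (w - 1) < 2"
    using that by (cases w) (auto intro: less_mult_imp_div_less)
  then have "x div 2 ^ (w - 1) = 0 \<or> x div 2 ^ (w - 1) = 1" by linarith
  then have "odd (x div 2 ^ (w - 1)) \<longleftrightarrow> 0 < x div 2 ^ (w - 1)" by (elim disjE) simp_all
  then show ?thesis by (simp add: bit_iff_odd div_greater_zero_iff)
qed

text \<open>Let h = 2 ^ (w - 1). If t < h, then x reaches t iff its top bit is set or its low part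
  reaches t; otherwise the top bit must be set and the low part must reach that of t. The bound t =
  r * b is known when the program is written, so the choice costs no run time.\<close>

definition ge_op :: "nat \<Rightarrow> nat \<Rightarrow> alu_op" where
  "ge_op w t = (if t < 2 ^ (w - 1) then BitOr else BitAnd)"

text \<open>With h = 2 ^ (w - 1), the low parts are compared by the top bit of f mod h + (h - t mod
  h), a sum below 2 ^ w, so nothing leaks into the next lane. \<open>ge_op\<close> combines this bit
  with the top bit of f, and H keeps it only in the lanes satisfying q.\<close>

lemma lanes_ge:
  assumes "0 < w" "lanes w X f" "t < 2 ^ w"
    and "lanes w L (\<lambda>j. mask (w - 1))" "lanes w C (\<lambda>j. 2 ^ (w - 1) - t mod 2 ^ (w - 1))"
    and "lanes w H (\<lambda>j. 2 ^ (w - 1) * of_bool (q j))"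
  shows "lanes w (alu (w * w) BitAnd (alu (w * w) (ge_op w t)
      (alu (w * w) Add (alu (w * w) BitAnd X L) C) X) H)
    (\<lambda>j. 2 ^ (w - 1) * of_bool (q j \<and> t \<le> f j))"
proof -
  let ?h = "2 ^ (w - 1) :: nat" 
  let ?s = "\<lambda>j. f j mod ?h + (?h - t mod ?h)"
  have w: "(2::nat) ^ w = ?h + ?h" using assms(1) by (cases w) auto
  have s_less: "?s j < 2 ^ w" for j
    unfolding w by (intro add_less_le_mono) auto
  have L: "lanes w (alu (w * w) BitAnd X L) (\<lambda>j. f j mod ?h)"
    by (rule lanes_cong[OF lanes_and[OF assms(1,2,4)]]) (simp add: take_bit_eq_mod flip: take_bit_eq_mask)
  have s: "lanes w (alu (w * w) Add (alu (w * w) BitAnd X L) C) ?s"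
    by (rule lanes_add[OF L assms(5) s_less])
  have h: "bit (?s j) (w - 1) \<longleftrightarrow> t mod ?h \<le> f j mod ?h" for j
  proof -
    have "t mod ?h < ?h" by simp
    then show ?thesis unfolding bit_top_iff[OF assms(1) s_less] by linarith
  qed
  have top: "Bit_Operations.and y (?h * of_bool (q j)) = ?h * of_bool (q j \<and> bit y (w - 1))" for y j
    by (cases "q j") (simp_all add: and_exp_eq_of_bool)
  have f: "bit (f j) (w - 1) \<longleftrightarrow> ?h \<le> f j" if "j < w" for j
    by (rule bit_top_iff[OF assms(1) lanes_lane_less[OF assms(2) that]])
  have md: "x mod ?h = (if x < ?h then x else x - ?h)" if "x < 2 ^ w" for x
    using that w by (auto simp: le_mod_geq)
  show ?thesis
  proof (cases "t < ?h")
    case True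
    then have eq: "ge_op w t = BitOr" by (simp add: ge_op_def)
    show ?thesis unfolding eq
    proof (rule lanes_cong[OF lanes_and[OF assms(1) lanes_or[OF assms(1) s assms(2)] assms(6)]])
      fix j assume j: "j < w"
      have "(bit (?s j) (w - 1) \<or> bit (f j) (w - 1)) \<longleftrightarrow> t \<le> f j"
        unfolding h f[OF j] unfolding md[OF lanes_lane_less[OF assms(2) j]] using True by auto
      then show "Bit_Operations.and (Bit_Operations.or (?s j) (f j)) (?h * of_bool (q j)) =
          ?h * of_bool (q j \<and> t \<le> f j)"
        unfolding top bit_or_iff by simp
    qed
  next
    case False
    then have eq: "ge_op w t = BitAnd" by (simp add: ge_op_def)
    show ?thesis unfolding eq
    proof (rule lanes_cong[OF lanes_and[OF assms(1) lanes_and[OF assms(1) s assms(2)] assms(6)]])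
      fix j assume j: "j < w"
      have "(bit (?s j) (w - 1) \<and> bit (f j) (w - 1)) \<longleftrightarrow> t \<le> f j"
        unfolding h f[OF j] unfolding md[OF lanes_lane_less[OF assms(2) j]] md[OF assms(3)] using False by auto
      then show "Bit_Operations.and (Bit_Operations.and (?s j) (f j)) (?h * of_bool (q j)) =
          ?h * of_bool (q j \<and> t \<le> f j)"
        unfolding top bit_and_iff by simp
    qed
  qed
qed

lemma lanes_top:
  assumes "0 < w" "lanes w X f" "lanes w H (\<lambda>j. 2 ^ (w - 1) * of_bool (q j))"
  shows "lanes w (alu (w * w) BitAnd X H) (\<lambda>j. 2 ^ (w - 1) * of_bool (q j \<and> 2 ^ (w - 1) \<le> f j))"
proof (rule lanes_cong[OF lanes_and[OF assms]])
  fix j assume j: "j < w"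
  show "Bit_Operations.and (f j) (2 ^ (w - 1) * of_bool (q j)) =
      2 ^ (w - 1) * of_bool (q j \<and> 2 ^ (w - 1) \<le> f j)"
    using bit_top_iff[OF assms(1) lanes_lane_less[OF assms(2) j]]
    by (cases "q j") (simp_all add: and_exp_eq_of_bool)
qed

lemma compress_lanes:
  assumes "0 < w" "lanes w X (\<lambda>j. of_bool (p j))"
  shows "\<forall>n. bit X n \<longrightarrow> w dvd n" "compress w X = horner_sum of_bool 2 (map p [0..<w])"
proof -
  have "n mod w = 0" if "bit X n" for n
    using that lanes_bit[OF assms(2,1), of n] by (auto simp: of_bool_def bit_Suc_0_iff split: if_splits)
  then show "\<forall>n. bit X n \<longrightarrow> w dvd n" by (simp add: dvd_eq_mod_eq_0)
  show "compress w X = horner_sum of_bool 2 (map p [0..<w])"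
    unfolding compress_def
    by (intro arg_cong[of _ _ "horner_sum of_bool 2"] map_cong)
       (auto simp: lanes_block[OF assms(2)] bit_Suc_0_iff)
qed

lemma spread_lanes: "0 < w \<Longrightarrow> lanes w (spread w X) (\<lambda>j. of_bool (bit X j))"
  unfolding spread_def using one_less_power[of "2::nat" w] by (intro lanes_of_blocks) simp

text \<open>\<open>ReadBlock\<close> replaces a single lane; on a cleared register the result is the
  word itself, which is what \<open>Spread\<close> expects.\<close>

lemma of_blocks_first: "0 < w \<Longrightarrow> of_blocks w ((\<lambda>_. 0)(0 := v)) = v"
proof -
  assume "0 < w"
  have "of_blocks w ((\<lambda>_. 0)(0 := v)) = (\<Sum>j<w. if j = 0 then v else 0)"
    unfolding of_blocks_eq_sum by (rule sum.cong) auto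
  then show ?thesis using \<open>0 < w\<close> by simp
qed

section \<open>Execution of straight-line code\<close>

lemma bind_funpow_None:
  fixes f :: "'s \<Rightarrow> 's option"
  shows "((\<lambda>x. Option.bind x f) ^^ n) None = None"
  by (induction n) auto

lemma steps_0 [simp]: "steps f 0 s = Some s"
  by (simp add: steps_def)

lemma steps_Suc: "steps f (Suc n) s = Option.bind (f s) (steps f n)"
  by (cases "f s") (simp_all add: steps_def funpow_Suc_right bind_funpow_None del: funpow.simps)

type_synonym uw_code = "(nat, nat) uw_instr list"

definition agree_outside :: "nat \<Rightarrow> nat set \<Rightarrow> uw_state \<Rightarrow> uw_state \<Rightarrow> bool" where
  "agree_outside w S u v \<longleftrightarrow> (\<forall>a<2 ^ w. a \<notin> S \<longrightarrow> mem v a = mem u a)"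

text \<open>\<open>implements\<close> constrains the memory in every intermediate state, so the
  restriction is carried along with reachability and composed with it.\<close>

definition reaches :: "nat \<Rightarrow> nat set \<Rightarrow> uw_code \<Rightarrow> nat \<Rightarrow> uw_state \<Rightarrow> uw_state \<Rightarrow> bool" where
  "reaches w S P T u v \<longleftrightarrow> steps (uw_step w P) T u = Some v \<and> uw_writes_within w P T u S"

lemma reaches_0: "reaches w S P 0 u u"
  by (simp add: reaches_def uw_writes_within_def)

lemma reaches_Suc:
  assumes "uw_step w P u = Some z" "agree_outside w S u z" "reaches w S P T z v"
  shows "reaches w S P (Suc T) u v"
  unfolding reaches_def
proof
  show "steps (uw_step w P) (Suc T) u = Some v"
    using assms by (simp add: steps_Suc reaches_def)
  show "uw_writes_within w P (Suc T) u S"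
    unfolding uw_writes_within_def
  proof (intro allI impI)
    fix t v a
    assume "t \<le> Suc T" and v: "steps (uw_step w P) t u = Some v" and a: "a < 2 ^ w" "a \<notin> S"
    show "mem v a = mem u a"
    proof (cases t)
      case 0
      then show ?thesis using v by simp
    next
      case (Suc t')
      then have "steps (uw_step w P) t' z = Some v" "t' \<le> T"
        using v \<open>t \<le> Suc T\<close> assms(1) by (simp_all add: steps_Suc)
      then have "mem v a = mem z a"
        using assms(3) a by (simp add: reaches_def uw_writes_within_def)
      then show ?thesis using assms(2) a by (simp add: agree_outside_def)
    qed
  qed
qed

lemma reaches_trans:
  "reaches w S P T u z \<Longrightarrow> reaches w S P T' z v \<Longrightarrow> reaches w S P (T + T') u v"
proof (induction T arbitrary: u)
  case 0
  then show ?case by (simp add: reaches_def)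
next
  case (Suc T)
  then obtain y where y: "uw_step w P u = Some y" "steps (uw_step w P) T y = Some z"
    by (auto simp: reaches_def steps_Suc bind_eq_Some_conv)
  have W: "uw_writes_within w P (Suc T) u S" using Suc.prems by (simp add: reaches_def)
  have first: "agree_outside w S u y"
    using W y(1) unfolding uw_writes_within_def agree_outside_def
    by (metis One_nat_def Suc_le_mono bind.bind_lunit le0 steps_0 steps_Suc)
  have "mem v' a = mem y a"
    if "t \<le> T" "steps (uw_step w P) t y = Some v'" "a < 2 ^ w" "a \<notin> S" for t v' a
  proof -
    have "steps (uw_step w P) (Suc t) u = Some v'" using that y by (simp add: steps_Suc)
    then have "mem v' a = mem u a"
      using W that unfolding uw_writes_within_def by (meson Suc_le_mono)
    then show ?thesis using first that by (simp add: agree_outside_def)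
  qed
  then have "reaches w S P T y z" using y(2) by (auto simp: reaches_def uw_writes_within_def)
  from reaches_Suc[OF y(1) first Suc.IH[OF this Suc.prems(2)]] show ?case by simp
qed

text \<open>Makes no reference to the surrounding program: each instruction must advance
  \<open>pc\<close> by one, so a piece of code is verified on its own and then placed anywhere by
  \<open>exec_reaches\<close>.\<close>

primrec exec :: "nat \<Rightarrow> nat set \<Rightarrow> uw_code \<Rightarrow> uw_state \<Rightarrow> uw_state \<Rightarrow> bool" where
  "exec w S [] u v \<longleftrightarrow> v = u"
| "exec w S (I # Is) u v \<longleftrightarrow>
     (\<exists>z. uw_exec w I u = Some z \<and> pc z = Suc (pc u) \<and> agree_outside w S u z \<and> exec w S Is z v)"

lemma exec_append: "exec w S (Is @ Js) u v \<longleftrightarrow> (\<exists>z. exec w S Is u z \<and> exec w S Js z v)"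
  by (induction Is arbitrary: u) auto

lemma exec_appendI: "exec w S Is u z \<Longrightarrow> exec w S Js z v \<Longrightarrow> exec w S (Is @ Js) u v"
  unfolding exec_append by blast

lemma exec_pc: "exec w S Is u v \<Longrightarrow> pc v = pc u + length Is"
  by (induction Is arbitrary: u) auto

lemma exec_reaches:
  "exec w S Is u v \<Longrightarrow> pc u + length Is \<le> length P \<Longrightarrow>
    (\<And>k. k < length Is \<Longrightarrow> P ! (pc u + k) = Is ! k) \<Longrightarrow> reaches w S P (length Is) u v"
proof (induction Is arbitrary: u)
  case Nil
  then show ?case by (simp add: reaches_0)
next
  case (Cons I Is)
  then obtain z where z: "uw_exec w I u = Some z" "pc z = Suc (pc u)" "agree_outside w S u z"
      "exec w S Is z v" by auto
  have "P ! pc u = I" using Cons.prems(3)[of 0] by simp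
  then have "uw_step w P u = Some z" using Cons.prems(2) z(1) by (simp add: uw_step_def)
  moreover have "reaches w S P (length Is) z v"
  proof (rule Cons.IH[OF z(4)])
    fix k assume "k < length Is"
    then show "P ! (pc z + k) = Is ! k" using Cons.prems(3)[of "Suc k"] z(2) by simp
  qed (use Cons.prems(2) z(2) in simp)
  ultimately show ?case using z(3) by (auto intro: reaches_Suc)
qed

definition wide_frame :: "nat set \<Rightarrow> uw_state \<Rightarrow> uw_state \<Rightarrow> bool" where
  "wide_frame Xs u v \<longleftrightarrow> mem v = mem u \<and> reg v = reg u \<and> (\<forall>x. x \<notin> Xs \<longrightarrow> wide v x = wide u x)"

lemmas state_defs = advance_def set_wide_def set_reg_def set_mem_def

section \<open>Masks\<close>

text \<open>
  The static wide registers are \<open>0\<close> (zero), \<open>1\<close> (offset of table cell \<open>j\<close> of register \<open>0\<close>),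
  \<open>2\<close> and \<open>3\<close> (operands of the comparison with \<open>r * b\<close>), \<open>4\<close> (top bits of the first \<open>b\<close> lanes),
  \<open>5\<close> (a shift distance), \<open>6\<close> and \<open>7\<close> (dummy addresses in the upper and lower half).
  Wide registers from \<open>8\<close> on are temporary and hold \<open>0\<close> between simulated instructions.
\<close>

definition wide_const :: "nat \<Rightarrow> nat \<Rightarrow> nat \<Rightarrow> nat \<Rightarrow> nat" where
  "wide_const w b r x =
     (if x = 1 then of_blocks w (\<lambda>j. take_bit w (if j < b then j * r else 0))
      else if x = 2 then of_blocks w (\<lambda>j. mask (w - 1))
      else if x = 3 then of_blocks w (\<lambda>j. 2 ^ (w - 1) - r * b mod 2 ^ (w - 1))
      else if x = 4 then of_blocks w (\<lambda>j. 2 ^ (w - 1) * of_bool (j < b))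
      else if x = 5 then w - 1
      else if x = 6 then of_blocks w (\<lambda>j. 2 ^ (w - 1) + j)
      else if x = 7 then of_blocks w (\<lambda>j. j)
      else 0)"

text \<open>Each half of the offsets has to supply w distinct dummies; it is large enough even for
  the smallest words.\<close>

lemma index_less_half: "j < w \<Longrightarrow> j < (2::nat) ^ (w - 1)"
proof -
  assume "j < w"
  then have "j \<le> w - 1" by simp
  also have "w - 1 < 2 ^ (w - 1)" by (rule less_exp)
  finally show ?thesis .
qed

lemma half_double: "0 < w \<Longrightarrow> (2::nat) ^ w = 2 ^ (w - 1) + 2 ^ (w - 1)"
  by (cases w) auto

lemma
  assumes "0 < w"
  shows lanes_const_0: "lanes w (wide_const w b r 0) (\<lambda>j. 0)"
    and lanes_const_1: "lanes w (wide_const w b r 1) (\<lambda>j. take_bit w (if j < b then j * r else 0))"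
    and lanes_const_2: "lanes w (wide_const w b r 2) (\<lambda>j. mask (w - 1))"
    and lanes_const_3: "lanes w (wide_const w b r 3) (\<lambda>j. 2 ^ (w - 1) - r * b mod 2 ^ (w - 1))"
    and lanes_const_4: "lanes w (wide_const w b r 4) (\<lambda>j. 2 ^ (w - 1) * of_bool (j < b))"
    and const_5: "wide_const w b r 5 = w - 1"
    and lanes_const_6: "lanes w (wide_const w b r 6) (\<lambda>j. 2 ^ (w - 1) + j)"
    and lanes_const_7: "lanes w (wide_const w b r 7) (\<lambda>j. j)"
proof -
  note w = half_double[OF assms]
  have pos: "(0::nat) < 2 ^ (w - 1)" by simp
  have half: "(2::nat) ^ (w - 1) - n < 2 ^ w" for n using w pos by linarith
  show "lanes w (wide_const w b r 0) (\<lambda>j. 0)"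
    by (simp add: wide_const_def lanes_def of_blocks_eq_sum)
  show "lanes w (wide_const w b r 2) (\<lambda>j. mask (w - 1))"
    using half[of 1] by (simp add: wide_const_def mask_eq_exp_minus_1 lanes_of_blocks)
  show "lanes w (wide_const w b r 3) (\<lambda>j. 2 ^ (w - 1) - r * b mod 2 ^ (w - 1))"
    using half by (simp add: wide_const_def lanes_of_blocks)
  show "lanes w (wide_const w b r 4) (\<lambda>j. 2 ^ (w - 1) * of_bool (j < b))"
    using half[of 0] by (simp add: wide_const_def lanes_of_blocks of_bool_def)
  show "lanes w (wide_const w b r 6) (\<lambda>j. 2 ^ (w - 1) + j)"
    using index_less_half by (simp add: wide_const_def lanes_of_blocks w)
  show "lanes w (wide_const w b r 7) (\<lambda>j. j)"
    using index_less_half by (simp add: wide_const_def lanes_of_blocks w trans_less_add1)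
qed (simp_all add: wide_const_def lanes_of_blocks)

text \<open>\<open>encoding\<close> fixes the constants before the layout is known to fit into the
  address space. This is why the offsets in constant \<open>1\<close> are truncated to w
  bits.\<close>

lemma wide_const_less:
  assumes "0 < w"
  shows "wide_const w b r x < 2 ^ (w * w)"
proof -
  have "w - 1 < 2 ^ (w - 1)" by (rule less_exp)
  also have "\<dots> \<le> (2::nat) ^ (w * w)" by (intro power_increasing) (auto intro: order_trans[OF diff_le_self])
  finally have const_5_less: "w - 1 < 2 ^ (w * w)" .
  consider "x \<in> {1,2,3,4,6,7}" | "x = 5" | "x = 0 \<or> x > 7"
    by (cases "x \<le> 7") (auto simp: le_Suc_eq numeral_eq_Suc)
  then show ?thesis
  proof cases
    case 1
    then show ?thesis
      using lanes_less[OF lanes_const_1[OF assms]] lanes_less[OF lanes_const_2[OF assms]]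
        lanes_less[OF lanes_const_3[OF assms]] lanes_less[OF lanes_const_4[OF assms]]
        lanes_less[OF lanes_const_6[OF assms]] lanes_less[OF lanes_const_7[OF assms]] by auto
  qed (use const_5_less in \<open>auto simp: wide_const_def\<close>)
qed

definition full_mask_code :: "nat \<Rightarrow> uw_code" where
  "full_mask_code a = [WideAlu ShiftR 10 a 5, WideAlu Sub 10 a 10, WideAlu Add a a 10]"

lemma exec_full_mask_code:
  assumes "0 < w" "wide u 5 = w - 1" "a \<notin> {5, 10}"
    and "lanes w (wide u a) (\<lambda>j. 2 ^ (w - 1) * of_bool (p j))"
  shows "\<exists>v. exec w S (full_mask_code a) u v \<and> lanes w (wide v a) (lane_mask w p) \<and> wide_frame {a, 10} u v"
  using lanes_full_mask[OF assms(1,4)] assms(2,3)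
  by (simp add: full_mask_code_def state_defs agree_outside_def wide_frame_def del: alu.simps)

definition bit_cell_mask_code :: "nat \<Rightarrow> nat \<Rightarrow> nat \<Rightarrow> nat \<Rightarrow> uw_code" where
  "bit_cell_mask_code w t e a =
     [WideAlu BitAnd a e 2, WideAlu Add a a 3, WideAlu (ge_op w t) a a e, WideAlu BitAnd a a 4]
     @ full_mask_code a"

text \<open>Only the lanes below b come from table cells of the register; the others contain
  whatever the fetch delivered. Constant \<open>4\<close> holds top bits in the first b lanes alone
  and so discards the rest.\<close>

lemma exec_bit_cell_mask_code:
  assumes "0 < w" "\<And>x. x < 8 \<Longrightarrow> wide u x = wide_const w b r x" "8 \<le> a" "a \<notin> {10, e}"
    and "lanes w (wide u e) f" "r * b < 2 ^ w"
  shows "\<exists>v. exec w S (bit_cell_mask_code w (r * b) e a) u v \<and>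
    lanes w (wide v a) (lane_mask w (\<lambda>j. j < b \<and> r * b \<le> f j)) \<and> wide_frame {a, 10} u v"
proof -
  let ?is = "[WideAlu BitAnd a e 2, WideAlu Add a a 3, WideAlu (ge_op w (r * b)) a a e,
    WideAlu BitAnd a a 4]"
  have "\<exists>z. exec w S ?is u z \<and> wide_frame {a} u z \<and>
      wide z a = alu (w * w) BitAnd (alu (w * w) (ge_op w (r * b))
        (alu (w * w) Add (alu (w * w) BitAnd (wide u e) (wide u 2)) (wide u 3)) (wide u e)) (wide u 4)"
    using assms(3,4) by (simp add: state_defs agree_outside_def wide_frame_def del: alu.simps)
  then obtain z where z: "exec w S ?is u z" "wide_frame {a} u z"
    "wide z a = alu (w * w) BitAnd (alu (w * w) (ge_op w (r * b))
        (alu (w * w) Add (alu (w * w) BitAnd (wide u e) (wide u 2)) (wide u 3)) (wide u e)) (wide u 4)"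
    by blast
  have "lanes w (wide z a) (\<lambda>j. 2 ^ (w - 1) * of_bool (j < b \<and> r * b \<le> f j))"
    unfolding z(3) assms(2)[of 2, simplified] assms(2)[of 3, simplified] assms(2)[of 4, simplified]
    by (intro lanes_ge lanes_const_2 lanes_const_3 lanes_const_4 assms(1,5,6))
  moreover have "wide z 5 = w - 1"
    using z(2) assms(2)[of 5] assms(3) by (simp add: wide_frame_def const_5[OF assms(1)])
  ultimately obtain v where "exec w S (full_mask_code a) z v"
      "lanes w (wide v a) (lane_mask w (\<lambda>j. j < b \<and> r * b \<le> f j))" "wide_frame {a, 10} z v"
    using exec_full_mask_code[OF assms(1), of z a] assms(3,4) by fastforce
  then show ?thesis
    using z(1,2) unfolding bit_cell_mask_code_def exec_append
    by (intro exI[of _ v]) (auto simp: wide_frame_def simp del: exec.simps)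
qed

text \<open>Half of the address space is the threshold here, so the comparison is just the top bit
  of the entry.\<close>

definition upper_mask_code :: "nat \<Rightarrow> nat \<Rightarrow> uw_code" where
  "upper_mask_code e a = WideAlu BitAnd a e 4 # full_mask_code a"

lemma exec_upper_mask_code:
  assumes "0 < w" "\<And>x. x < 8 \<Longrightarrow> wide u x = wide_const w b r x" "8 \<le> a" "a \<notin> {10, e}"
    and "lanes w (wide u e) f"
  shows "\<exists>v. exec w S (upper_mask_code e a) u v \<and>
    lanes w (wide v a) (lane_mask w (\<lambda>j. j < b \<and> 2 ^ (w - 1) \<le> f j)) \<and> wide_frame {a, 10} u v"
proof -
  have "\<exists>z. exec w S [WideAlu BitAnd a e 4] u z \<and> wide_frame {a} u z \<and>
      wide z a = alu (w * w) BitAnd (wide u e) (wide u 4)"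
    using assms(3,4) by (simp add: state_defs agree_outside_def wide_frame_def del: alu.simps)
  then obtain z where z: "exec w S [WideAlu BitAnd a e 4] u z" "wide_frame {a} u z"
      "wide z a = alu (w * w) BitAnd (wide u e) (wide u 4)"
    by blast
  have "lanes w (wide z a) (\<lambda>j. 2 ^ (w - 1) * of_bool (j < b \<and> 2 ^ (w - 1) \<le> f j))"
    unfolding z(3) assms(2)[of 4, simplified] by (intro lanes_top lanes_const_4 assms(1,5))
  moreover have "wide z 5 = w - 1"
    using z(2) assms(2)[of 5] assms(3) by (simp add: wide_frame_def const_5[OF assms(1)])
  ultimately obtain v where v: "exec w S (full_mask_code a) z v"
      "lanes w (wide v a) (lane_mask w (\<lambda>j. j < b \<and> 2 ^ (w - 1) \<le> f j))" "wide_frame {a, 10} z v"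
    using exec_full_mask_code[OF assms(1), of z a] assms(3,4) by fastforce
  have "exec w S ([WideAlu BitAnd a e 4] @ full_mask_code a) u v"
    using z(1) v(1) unfolding exec_append by blast
  then show ?thesis
    using z(2) v unfolding upper_mask_code_def append_Cons append_Nil
    by (intro exI[of _ v]) (auto simp: wide_frame_def simp del: exec.simps)
qed

section \<open>Masked gather and scatter\<close>

lemma gather_lanes:
  assumes "lanes w X f" "\<And>a. a < 2 ^ w \<Longrightarrow> mem u a < 2 ^ w"
  shows "lanes w (gather w (\<lambda>j. (M + block w X j) mod 2 ^ w) u) (\<lambda>j. mem u ((M + f j) mod 2 ^ w))"
  unfolding gather_def
  by (rule lanes_cong[OF lanes_of_blocks]) (auto simp: assms(2) lanes_block[OF assms(1)])

lemma scatter_lanes: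
  assumes "lanes w X f" "lanes w D g" "inj_on (\<lambda>j. (M + f j) mod 2 ^ w) {..<w}"
  obtains v where "scatter w (\<lambda>j. (M + block w X j) mod 2 ^ w) D u = Some (u\<lparr>mem := v\<rparr>)"
    and "\<And>j. j < w \<Longrightarrow> v ((M + f j) mod 2 ^ w) = g j"
    and "\<And>a. (\<And>j. j < w \<Longrightarrow> a \<noteq> (M + f j) mod 2 ^ w) \<Longrightarrow> v a = mem u a"
proof -
  let ?a = "\<lambda>j. (M + block w X j) mod 2 ^ w"
  have a: "?a j = (M + f j) mod 2 ^ w" if "j < w" for j
    using that by (simp add: lanes_block[OF assms(1)])
  have inj: "inj_on ?a {..<w}"
    using assms(3) by (rule inj_on_cong[THEN iffD2, rotated]) (simp add: a)
  define v where "v = (\<lambda>c. if c \<in> ?a ` {..<w} then block w D (inv_into {..<w} ?a c) else mem u c)"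
  show thesis
  proof
    show "scatter w ?a D u = Some (u\<lparr>mem := v\<rparr>)"
      using inj by (simp add: scatter_def v_def)
    fix j assume j: "j < w"
    have "v (?a j) = g j"
      using j lanes_block[OF assms(2) j] unfolding v_def by (simp add: inv_into_f_f[OF inj])
    then show "v ((M + f j) mod 2 ^ w) = g j" by (simp add: a j)
  next
    fix c assume "\<And>j. j < w \<Longrightarrow> c \<noteq> (M + f j) mod 2 ^ w"
    then have "c \<notin> ?a ` {..<w}" using a by auto
    then show "v c = mem u c" by (simp add: v_def)
  qed
qed

text \<open>
  A content write always uses all \<open>w\<close> lanes, and their addresses must be distinct. The lanes
  outside the mask therefore write back the words found at the dummy addresses \<open>k\<close>.
\<close>

definition masked_write_code :: "nat \<Rightarrow> nat \<Rightarrow> nat \<Rightarrow> uw_code" where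
  "masked_write_code M a k =
     [WideNot 11 a, WideAlu BitAnd 12 8 a, WideAlu BitAnd 13 k 11, WideAlu BitOr 12 12 13,
      WideAlu BitOr 13 12 0, ReadContent 13 (Direct M), WideAlu BitAnd 13 13 11,
      WideAlu BitAnd 15 14 a, WideAlu BitOr 13 15 13]
     @ [WriteContent (Direct M) 12 13]"

lemma exec_masked_write_code:
  assumes "0 < w" "a \<notin> {11, 12, 13, 15}" "k \<notin> {11, 12, 13, 15}" "wide u 0 = 0"
    and mem: "\<And>c. c < 2 ^ w \<Longrightarrow> mem u c < 2 ^ w"
    and lanes: "lanes w (wide u 8) e" "lanes w (wide u 14) d" "lanes w (wide u k) q"
      "lanes w (wide u a) (lane_mask w p)"
    and inj: "inj_on (\<lambda>j. (M + (if p j then e j else q j)) mod 2 ^ w) {..<w}"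
    and S: "\<And>j. j < w \<Longrightarrow> p j \<Longrightarrow> (M + e j) mod 2 ^ w \<in> S"
  obtains v where "exec w S (masked_write_code M a k) u v" "reg v = reg u"
    "\<And>x. x \<notin> {11, 12, 13, 15} \<Longrightarrow> wide v x = wide u x"
    "\<And>j. j < w \<Longrightarrow> p j \<Longrightarrow> mem v ((M + e j) mod 2 ^ w) = d j"
    "\<And>c. (\<And>j. j < w \<Longrightarrow> p j \<Longrightarrow> c \<noteq> (M + e j) mod 2 ^ w) \<Longrightarrow> mem v c = mem u c"
proof -
  let ?is = "[WideNot 11 a, WideAlu BitAnd 12 8 a, WideAlu BitAnd 13 k 11, WideAlu BitOr 12 12 13,
      WideAlu BitOr 13 12 0, ReadContent 13 (Direct M), WideAlu BitAnd 13 13 11,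
      WideAlu BitAnd 15 14 a, WideAlu BitOr 13 15 13]"
  let ?n = "w * w"
  let ?N = "complement ?n (wide u a)"
  let ?X = "alu ?n BitOr (alu ?n BitAnd (wide u 8) (wide u a)) (alu ?n BitAnd (wide u k) ?N)"
  let ?C = "alu ?n BitOr ?X (wide u 0)"
  let ?D = "alu ?n BitOr (alu ?n BitAnd (wide u 14) (wide u a))
    (alu ?n BitAnd (gather w (\<lambda>j. (M + block w ?C j) mod 2 ^ w) u) ?N)"
  let ?f = "\<lambda>j. if p j then e j else q j"
  let ?ad = "\<lambda>j. (M + ?f j) mod 2 ^ w"
  have "\<exists>z. exec w S ?is u z \<and> wide_frame {11, 12, 13, 15} u z \<and> wide z 12 = ?X \<and> wide z 13 = ?D"
    using assms(2,3)
    by (simp add: state_defs agree_outside_def wide_frame_def gather_def del: alu.simps)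
  then obtain z where z: "exec w S ?is u z" "wide_frame {11, 12, 13, 15} u z"
      "wide z 12 = ?X" "wide z 13 = ?D"
    by blast
  have zero: "lanes w (wide u 0) (\<lambda>_. 0)"
    using assms(4) by (simp add: lanes_def of_blocks_eq_sum)
  note N = lanes_mask_not[OF assms(1) lanes(4)]
  have X: "lanes w ?X ?f"
    by (intro lanes_merge lanes_select N lanes assms(1))
  have C: "lanes w ?C ?f"
    by (rule lanes_copy[OF assms(1) X zero])
  have D: "lanes w ?D (\<lambda>j. if p j then d j else mem u (?ad j))"
    by (intro lanes_merge lanes_select N lanes assms(1) gather_lanes C mem)
  have memz: "mem z = mem u" and regz: "reg z = reg u" using z(2) by (simp_all add: wide_frame_def)
  obtain m where m: "scatter w (\<lambda>j. (M + block w ?X j) mod 2 ^ w) ?D z = Some (z\<lparr>mem := m\<rparr>)"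
    "\<And>j. j < w \<Longrightarrow> m (?ad j) = (if p j then d j else mem u (?ad j))"
    "\<And>c. (\<And>j. j < w \<Longrightarrow> c \<noteq> ?ad j) \<Longrightarrow> m c = mem z c"
    by (rule scatter_lanes[OF X D inj, of z]) blast
  have active: "m ((M + e j) mod 2 ^ w) = d j" if "j < w" "p j" for j
    using m(2)[OF that(1)] that(2) by simp
  \<comment> \<open>A lane outside the mask stores the very word it read at its own address. Its
    write changes nothing, wherever the dummy lies, in particular outside \<open>S\<close>.\<close>
  have rest: "m c = mem u c" if c: "\<And>j. j < w \<Longrightarrow> p j \<Longrightarrow> c \<noteq> (M + e j) mod 2 ^ w" for c
  proof (cases "\<exists>j<w. c = ?ad j")
    case True
    then obtain j where j: "j < w" "c = ?ad j" by blast
    then have "\<not> p j" using c[OF j(1)] by auto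
    then show ?thesis using m(2)[OF j(1)] j(2) by simp
  next
    case False
    then show ?thesis using m(3) memz by auto
  qed
  let ?v = "advance (z\<lparr>mem := m\<rparr>)"
  have "m c = mem u c" if "c \<notin> S" for c
    by (rule rest) (use S that in auto)
  then have "agree_outside w S z ?v"
    by (simp add: agree_outside_def advance_def memz)
  then have "exec w S [WriteContent (Direct M) 12 13] z ?v"
    using m(1) by (simp add: z(3,4) advance_def del: alu.simps)
  then have "exec w S (masked_write_code M a k) u ?v"
    using z(1) unfolding masked_write_code_def exec_append by blast
  then show thesis
    by (rule that) (use z(2) regz active rest in \<open>auto simp: advance_def wide_frame_def\<close>)
qed

section \<open>The layout table\<close>

text \<open>The index j is itself a candidate for the minimum, so a position inside the list has its
  first occurrence inside the list, whatever \<open>!\<close> yields beyond the end.\<close>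

definition first_index :: "nat list \<Rightarrow> nat \<Rightarrow> nat" where
  "first_index ks j = (LEAST j'. ks ! j' = ks ! j)"

lemma nth_first_index: "ks ! first_index ks j = ks ! j"
  unfolding first_index_def by (rule LeastI) (rule refl)

lemma first_index_le: "first_index ks j \<le> j"
  unfolding first_index_def by (rule Least_le) (rule refl)

lemma first_index_cong: "ks ! j = ks ! j' \<Longrightarrow> first_index ks j = first_index ks j'"
  by (simp add: first_index_def)

lemma first_index_idem [simp]: "first_index ks (first_index ks j) = first_index ks j"
  by (rule first_index_cong) (rule nth_first_index)

text \<open>
  Offset \<open>j * r + i\<close> is the table cell of position \<open>j\<close> of register \<open>i\<close>, and offset \<open>r * b + k\<close>
  the cell of bit \<open>k\<close>. A table cell points to its bit cell only at the first occurrence of the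
  bit in the register; a repeated position points to the table cell of the first occurrence,
  and a missing position to itself. So a comparison with \<open>r * b\<close> recovers the lanes that may be
  written without conflict, although a word has no room for a flag besides the offset.
\<close>

definition table_entry :: "nat \<Rightarrow> nat \<Rightarrow> layout \<Rightarrow> nat \<Rightarrow> nat" where
  "table_entry r b R t =
     (let j = t div r; i = t mod r; ks = R i; j' = first_index ks j
      in if length ks \<le> j then t else if j' = j then r * b + ks ! j else j' * r + i)"

text \<open>The truncation makes every content a word, as \<open>encoding\<close> demands for
  arbitrary r and b; once the table fits into the address space, it is the identity on the
  entries.\<close>

definition cell_contents :: "nat \<Rightarrow> nat \<Rightarrow> nat \<Rightarrow> layout \<Rightarrow> (nat \<Rightarrow> bool) \<Rightarrow> nat \<Rightarrow> nat" where
  "cell_contents w r b R \<beta> t =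
     (if t < r * b then take_bit w (table_entry r b R t) else of_bool (\<beta> (t - r * b)))"

lemma encoding_cell_contents:
  assumes "0 < w"
  shows "encoding w (r * b + B) B c (cell_contents w r b R) (wide_const w b r)"
  unfolding encoding_def
proof (intro conjI allI impI)
  show "cell_contents w r b R \<beta> k < 2 ^ w" for \<beta> k
    using one_less_power[OF _ assms, of "2::nat"] by (simp add: cell_contents_def)
  show "(\<forall>k<r * b + B. cell_contents w r b R \<beta> k = cell_contents w r b R \<beta>' k) \<longleftrightarrow>
      (\<forall>k<B. \<beta> k = \<beta>' k)" for \<beta> \<beta>'
  proof
    assume *: "\<forall>k<r * b + B. cell_contents w r b R \<beta> k = cell_contents w r b R \<beta>' k"
    show "\<forall>k<B. \<beta> k = \<beta>' k"
    proof (intro allI impI)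
      fix k assume "k < B"
      then show "\<beta> k = \<beta>' k" using *[rule_format, of "r * b + k"] 
        by (cases "\<beta> k"; cases "\<beta>' k") (simp_all add: cell_contents_def)
    qed
  qed (auto simp: cell_contents_def)
qed (rule wide_const_less[OF assms])

text \<open>Positive B makes \<open>M\<close> an address inside the additional words, hence usable
  as scratch, and lets the threshold \<open>r * b\<close> fit into a word. Positive b makes
  \<open>M + i\<close> the address of a table cell for every register i.\<close>

locale fs_simulation =
  fixes w b r B M :: nat and R :: layout
  assumes w_pos: "0 < w" and layout: "fs_layout r b B R" and b_le: "b \<le> w"
    and space: "M + (r * b + B) \<le> 2 ^ w"
    and b_pos: "0 < b" and B_pos: "0 < B"
begin

abbreviation "S \<equiv> {..<M + (r * b + B)}"
abbreviation "entry \<equiv> table_entry r b R"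

lemma cell_offset_less: "i < r \<Longrightarrow> j < b \<Longrightarrow> j * r + i < r * b"
proof -
  assume "i < r" "j < b"
  then have "j * r + i < Suc j * r" by simp
  also have "\<dots> \<le> b * r" using \<open>j < b\<close> by (intro mult_right_mono) auto
  finally show ?thesis by (simp add: mult.commute)
qed

lemma table_size: "r * b < 2 ^ w"
  using space B_pos by linarith

lemma M_less: "M < 2 ^ w"
  using space B_pos by linarith

lemma length_le: "i < r \<Longrightarrow> length (R i) \<le> b"
  and bit_index_less: "i < r \<Longrightarrow> j < length (R i) \<Longrightarrow> R i ! j < B"
  using layout by (auto simp: fs_layout_def subset_eq)

lemma entry_cell:
  assumes "i < r"
  shows "entry (j * r + i) =
    (if length (R i) \<le> j then j * r + i
     else if first_index (R i) j = j then r * b + R i ! j else first_index (R i) j * r + i)"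
  using assms by (simp add: table_entry_def Let_def)

definition active :: "nat \<Rightarrow> nat \<Rightarrow> bool" where
  "active i j \<longleftrightarrow> j < length (R i) \<and> first_index (R i) j = j"

lemma entry_active: "i < r \<Longrightarrow> active i j \<Longrightarrow> entry (j * r + i) = r * b + R i ! j"
  by (simp add: entry_cell active_def)

lemma entry_less_if_not_active: "i < r \<Longrightarrow> j < b \<Longrightarrow> \<not> active i j \<Longrightarrow> entry (j * r + i) < r * b"
  using first_index_le[of "R i" j] by (auto simp: entry_cell active_def intro: cell_offset_less)

lemma entry_less: "i < r \<Longrightarrow> j < b \<Longrightarrow> entry (j * r + i) < r * b + B"
  using entry_active[of i j] entry_less_if_not_active[of i j] bit_index_less[of i j]
  by (cases "active i j") (auto simp: active_def)

lemma bit_cell_iff_active: "i < r \<Longrightarrow> j < b \<Longrightarrow> r * b \<le> entry (j * r + i) \<longleftrightarrow> active i j"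
  using entry_active[of i j] entry_less_if_not_active[of i j] by fastforce

text \<open>Positions with the same bit have the same first occurrence, and an active position is
  its own. Hence the active lanes of a register have distinct targets, as exclusive writes
  require.\<close>

lemma active_inj: "active i j \<Longrightarrow> active i j' \<Longrightarrow> R i ! j = R i ! j' \<Longrightarrow> j = j'"
  unfolding active_def by (metis first_index_cong)

lemma entry_less_word: "i < r \<Longrightarrow> j < b \<Longrightarrow> entry (j * r + i) < 2 ^ w"
  using entry_less[of i j] space by linarith

definition stores :: "(nat \<Rightarrow> bool) \<Rightarrow> uw_state \<Rightarrow> bool" where
  "stores \<beta> u \<longleftrightarrow> (\<forall>k<r * b + B. mem u (M + k) = cell_contents w r b R \<beta> k)"

lemma stores_table:
  assumes "stores \<beta> u" "i < r" "j < b"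
  shows "mem u (M + (j * r + i)) = entry (j * r + i)"
  using assms cell_offset_less[OF assms(2,3)] entry_less_word[OF assms(2,3)]
  by (simp add: stores_def cell_contents_def take_bit_nat_eq_self)

lemma stores_bit: "stores \<beta> u \<Longrightarrow> k < B \<Longrightarrow> mem u (M + (r * b + k)) = of_bool (\<beta> k)"
  by (simp add: stores_def cell_contents_def)

text \<open>The bound 18 covers the constants \<open>0\<close> to \<open>7\<close> and the
  temporaries \<open>8\<close> to \<open>17\<close>, for which \<open>wide_const\<close> is
  0.\<close>

definition ready :: "(nat \<Rightarrow> bool) \<Rightarrow> uw_state \<Rightarrow> bool" where
  "ready \<beta> u \<longleftrightarrow> stores \<beta> u \<and> (\<forall>a<2 ^ w. mem u a < 2 ^ w) \<and> (\<forall>x<18. wide u x = wide_const w b r x)"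

section \<open>Reading and writing a register\<close>

text \<open>\<open>K\<close> is the first register not belonging to the simulated program and holds
  the base address. The offsets are copied from \<open>1\<close> to \<open>8\<close> because a
  content read overwrites the register that supplies its addresses.\<close>

definition fetch_code :: "nat \<Rightarrow> nat operand \<Rightarrow> uw_code" where
  "fetch_code K i =
     map UW_Ordinary (case i of Direct a \<Rightarrow> [Const K (M + a)] | Indirect y \<Rightarrow> [Const K M, Alu Add K K y])
     @ [WideAlu BitOr 8 1 0, ReadContent 8 (Indirect K)]"

lemma exec_fetch_code:
  assumes "ready \<beta> u" "i' < r" "operand_val u i = i'" "K \<notin> set_operand i"
  obtains v e where "exec w S (fetch_code K i) u v" "mem v = mem u"
    "\<And>y. y \<noteq> K \<Longrightarrow> reg v y = reg u y" "\<And>x. x \<noteq> 8 \<Longrightarrow> wide v x = wide u x"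
    "lanes w (wide v 8) e" "\<And>j. j < b \<Longrightarrow> e j = entry (j * r + i')"
proof -
  have i'_less: "M + i' < 2 ^ w"
    using cell_offset_less[OF assms(2) b_pos] space by simp
  define X where "X = alu (w * w) BitOr (wide u 1) (wide u 0)"
  let ?f = "\<lambda>j. take_bit w (if j < b then j * r else 0)"
  have X: "lanes w X ?f"
  proof -
    have "wide u 0 = wide_const w b r 0" "wide u 1 = wide_const w b r 1"
      using assms(1) by (simp_all add: ready_def)
    then show ?thesis
      unfolding X_def by (simp only: lanes_copy[OF w_pos lanes_const_1[OF w_pos] lanes_const_0[OF w_pos]])
  qed
  define G where "G = gather w (\<lambda>j. (M + i' + block w X j) mod 2 ^ w) u"
  have G: "lanes w G (\<lambda>j. mem u ((M + i' + ?f j) mod 2 ^ w))"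
    unfolding G_def using assms(1) by (intro gather_lanes[OF X]) (simp add: ready_def)
  have "\<exists>v. exec w S (fetch_code K i) u v \<and> mem v = mem u \<and>
      (\<forall>y. y \<noteq> K \<longrightarrow> reg v y = reg u y) \<and> (\<forall>x. x \<noteq> 8 \<longrightarrow> wide v x = wide u x) \<and> wide v 8 = G"
    using i'_less assms(3,4) M_less
    by (cases i)
       (auto simp: fetch_code_def state_defs agree_outside_def gather_def G_def X_def
          take_bit_nat_eq_self Let_def)
  then obtain v where v: "exec w S (fetch_code K i) u v" "mem v = mem u"
      "\<And>y. y \<noteq> K \<Longrightarrow> reg v y = reg u y" "\<And>x. x \<noteq> 8 \<Longrightarrow> wide v x = wide u x" "wide v 8 = G"
    by blast
  have e: "mem u ((M + i' + ?f j) mod 2 ^ w) = entry (j * r + i')" if "j < b" for j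
  proof -
    have less: "j * r + i' < r * b" by (rule cell_offset_less[OF assms(2) that])
    then have "?f j = j * r" using that table_size by (simp add: take_bit_nat_eq_self)
    moreover have "(M + i' + j * r) mod 2 ^ w = M + (j * r + i')" using less space by simp
    ultimately show ?thesis
      using stores_table[OF _ assms(2) that, of \<beta> u] assms(1) by (simp add: ready_def)
  qed
  show thesis
  proof (rule that[OF v(1-4)])
    show "lanes w (wide v 8) (\<lambda>j. mem u ((M + i' + ?f j) mod 2 ^ w))" unfolding v(5) by (rule G)
  qed (assumption | rule e)+
qed

definition clear_code :: uw_code where
  "clear_code = map (\<lambda>x. WideAlu BitAnd x x 0) [8..<18]"

lemma exec_clear_code:
  assumes "wide u 0 = 0"
  obtains v where "exec w S clear_code u v" "mem v = mem u" "reg v = reg u"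
    "\<And>x. wide v x = (if 8 \<le> x \<and> x < 18 then 0 else wide u x)"
proof -
  have "\<exists>v. exec w S (map (\<lambda>x. WideAlu BitAnd x x 0) xs) u v \<and> mem v = mem u \<and> reg v = reg u \<and>
      (\<forall>x. wide v x = (if x \<in> set xs then 0 else wide u x))" if "0 \<notin> set xs" for xs
    using that assms
  proof (induction xs arbitrary: u)
    case Nil
    then show ?case by simp
  next
    case (Cons x xs)
    let ?z = "advance (set_wide x 0 u)"
    have step: "exec w S [WideAlu BitAnd x x 0] u ?z"
      using Cons.prems by (simp add: state_defs agree_outside_def)
    have z: "mem ?z = mem u" "reg ?z = reg u" "wide ?z = (wide u)(x := 0)"
      by (simp_all add: state_defs)
    then have "wide ?z 0 = 0" using Cons.prems by simp
    with Cons.IH[of ?z] Cons.prems(1) obtain v where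
      v: "exec w S (map (\<lambda>x. WideAlu BitAnd x x 0) xs) ?z v" "mem v = mem ?z"
        "reg v = reg ?z" "\<forall>y. wide v y = (if y \<in> set xs then 0 else wide ?z y)"
      by auto
    show ?case
    proof (intro exI conjI allI)
      show "exec w S (map (\<lambda>x. WideAlu BitAnd x x 0) (x # xs)) u v"
        using exec_appendI[OF step v(1)] unfolding list.map append_Cons append_Nil .
      show "wide v y = (if y \<in> set (x # xs) then 0 else wide u y)" for y
        unfolding v(4)[rule_format] z(3) by simp
    qed (simp_all only: v(2,3) z(1,2))
  qed
  moreover have "0 \<notin> set [8..<18::nat]" by simp
  ultimately obtain v where v: "exec w S (map (\<lambda>x. WideAlu BitAnd x x 0) [8..<18]) u v"
    "mem v = mem u" "reg v = reg u" "\<forall>x. wide v x = (if x \<in> set [8..<18] then 0 else wide u x)"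
    by blast
  show thesis
  proof (rule that)
    show "exec w S clear_code u v" unfolding clear_code_def by (rule v(1))
    show "wide v x = (if 8 \<le> x \<and> x < 18 then 0 else wide u x)" for x
      unfolding v(4)[rule_format] set_upt atLeastLessThan_iff ..
  qed (fact v)+
qed

lemma lanes_bits_of_register:
  assumes "i < r" and lanes: "lanes w X (\<lambda>j. if j < length (R i) then of_bool (\<beta> (R i ! j)) else 0)"
  shows "\<forall>n. bit X n \<longrightarrow> w dvd n" "block w (compress w X) 0 = read_bits (R i) \<beta>"
proof -
  have "lanes w X (\<lambda>j. of_bool (j < length (R i) \<and> \<beta> (R i ! j)))"
    using lanes by (rule lanes_cong) simp
  note * = compress_lanes[OF w_pos this]
  show "\<forall>n. bit X n \<longrightarrow> w dvd n" by (rule *)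
  show "block w (compress w X) 0 = read_bits (R i) \<beta>"
    unfolding *(2) block_def read_bits_def
    using length_le[OF assms(1)] b_le by (intro bit_eqI) (auto simp: bit_simps)
qed

text \<open>
  Repeated positions are resolved by following their pointers once more, before the bit cells
  are read. The value leaves the wide registers through the word at address \<open>M\<close>, whose contents
  are saved in the ordinary register \<open>Suc K\<close>.
\<close>

definition read_code :: "nat \<Rightarrow> nat \<Rightarrow> nat operand \<Rightarrow> uw_code" where
  "read_code K x i =
     fetch_code K i @ bit_cell_mask_code w (r * b) 8 9 @
     [WideAlu BitOr 17 8 0, ReadContent 17 (Direct M), WideAlu BitAnd 12 8 9, WideNot 11 9,
      WideAlu BitAnd 13 17 11, WideAlu BitOr 17 12 13] @
     bit_cell_mask_code w (r * b) 17 9 @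
     [ReadContent 17 (Direct M), WideAlu BitAnd 17 17 9] @
     [Compress 17 17, UW_Ordinary (Load (Suc K) (Direct M)), WriteBlock (Direct M) 17 (Direct 0),
      UW_Ordinary (Load x (Direct M)), UW_Ordinary (Store (Direct M) (Suc K))] @
     clear_code"

lemma exec_read_code:
  assumes u: "ready \<beta> u" and i': "i' < r" "operand_val u i = i'" "set_operand i \<subseteq> {..<K}" and x: "x < K"
  obtains v where "exec w S (read_code K x i) u v" "mem v = mem u"
    "\<And>y. y < K \<Longrightarrow> reg v y = (if y = x then read_bits (R i') \<beta> else reg u y)"
    "\<And>y. y < 18 \<Longrightarrow> wide v y = wide_const w b r y" "\<And>y. 18 \<le> y \<Longrightarrow> wide v y = wide u y"
proof -
  have const: "\<And>y. y < 18 \<Longrightarrow> wide u y = wide_const w b r y"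
    and mem: "\<And>a. a < 2 ^ w \<Longrightarrow> mem u a < 2 ^ w" and stores: "stores \<beta> u"
    using u by (auto simp: ready_def)
  obtain u1 e where u1: "exec w S (fetch_code K i) u u1" "mem u1 = mem u"
    "\<And>y. y \<noteq> K \<Longrightarrow> reg u1 y = reg u y" "\<And>x. x \<noteq> 8 \<Longrightarrow> wide u1 x = wide u x"
    "lanes w (wide u1 8) e" and e: "\<And>j. j < b \<Longrightarrow> e j = entry (j * r + i')"
    by (rule exec_fetch_code[OF u i'(1,2), of K]) (use i'(3) in auto)
  have e_bit: "j < b \<and> r * b \<le> e j \<longleftrightarrow> active i' j" for j
    using e bit_cell_iff_active[OF i'(1)] length_le[OF i'(1)]
    by (cases "j < b") (auto simp: active_def)
  obtain u2 where u2: "exec w S (bit_cell_mask_code w (r * b) 8 9) u1 u2"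
      "lanes w (wide u2 9) (lane_mask w (active i'))" "wide_frame {9, 10} u1 u2"
    using exec_bit_cell_mask_code[of w u1 b r 9 8 e S] u1(4,5) const w_pos table_size
    by (auto simp: e_bit)
  have u2_8: "lanes w (wide u2 8) e" using u1(5) u2(3) by (simp add: wide_frame_def)
  have u2_0: "lanes w (wide u2 0) (\<lambda>_. 0)"
    using u2(3) u1(4) const[of 0] lanes_const_0[OF w_pos] by (simp add: wide_frame_def)
  define F where "F = gather w (\<lambda>j. (M + block w (alu (w * w) BitOr (wide u2 8) (wide u2 0)) j) mod 2 ^ w) u"
  have F: "lanes w F (\<lambda>j. mem u ((M + e j) mod 2 ^ w))"
    unfolding F_def by (intro gather_lanes lanes_copy w_pos u2_8 u2_0 mem)
  define G where "G = alu (w * w) BitOr (alu (w * w) BitAnd (wide u2 8) (wide u2 9))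
    (alu (w * w) BitAnd F (complement (w * w) (wide u2 9)))"
  have "lanes w G (\<lambda>j. if active i' j then e j else mem u ((M + e j) mod 2 ^ w))"
    unfolding G_def by (intro lanes_merge lanes_select lanes_mask_not w_pos u2_8 u2(2) F)
  then obtain g where G: "lanes w G g"
    and g: "\<And>j. g j = (if active i' j then e j else mem u ((M + e j) mod 2 ^ w))"
    by blast
  \<comment> \<open>A repeated position points to the table cell of its first occurrence, which is
    active and points to the bit; so one further indirection is enough.\<close>
  have g_bit: "g j = r * b + R i' ! j" if "j < length (R i')" for j
  proof (cases "active i' j")
    case True
    then show ?thesis
      using that length_le[OF i'(1)] e entry_active[OF i'(1) True] by (simp add: g)
  next
    case False
    let ?j = "first_index (R i') j"
    have j: "j < b" using that length_le[OF i'(1)] by simp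
    have act: "active i' ?j" and j': "?j < b"
      using that j first_index_le[of "R i'" j] by (auto simp: active_def)
    have "e j = ?j * r + i'"
      using False that e[OF j] by (auto simp: entry_cell[OF i'(1)] active_def)
    moreover have "(M + (?j * r + i')) mod 2 ^ w = M + (?j * r + i')"
      using cell_offset_less[OF i'(1) j'] space by simp
    ultimately have "g j = entry (?j * r + i')"
      using False stores_table[OF stores i'(1) j'] by (simp add: g)
    also have "\<dots> = r * b + R i' ! j"
      by (simp add: entry_active[OF i'(1) act] nth_first_index)
    finally show ?thesis .
  qed
  \<comment> \<open>A missing position points to itself, so following the pointer leads back to the
    same table cell. The second comparison with \<open>r * b\<close> thus marks precisely the
    positions present in the register.\<close>
  have g_none: "g j < r * b" if "length (R i') \<le> j" "j < b" for j
  proof -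
    have "\<not> active i' j" "e j = j * r + i'"
      using that e[OF that(2)] by (auto simp: active_def entry_cell[OF i'(1)])
    moreover have "j * r + i' < r * b" by (rule cell_offset_less[OF i'(1) that(2)])
    moreover have "entry (j * r + i') < r * b"
      using \<open>\<not> active i' j\<close> entry_less_if_not_active[OF i'(1) that(2)] by simp
    ultimately show ?thesis
      using stores_table[OF stores i'(1) that(2)] space by (simp add: g)
  qed
  have g_iff: "j < b \<and> r * b \<le> g j \<longleftrightarrow> j < length (R i')" for j
    using g_bit[of j] g_none[of j] length_le[OF i'(1)] by (cases "j < length (R i')") auto
  have "\<exists>z. exec w S [WideAlu BitOr 17 8 0, ReadContent 17 (Direct M), WideAlu BitAnd 12 8 9,
      WideNot 11 9, WideAlu BitAnd 13 17 11, WideAlu BitOr 17 12 13] u2 z \<and>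
      wide_frame {11, 12, 13, 17} u2 z \<and> wide z 17 = G"
    using u2(3) u1(2)
    by (simp add: state_defs agree_outside_def wide_frame_def gather_def F_def G_def del: alu.simps)
  then obtain u3 where u3: "exec w S [WideAlu BitOr 17 8 0, ReadContent 17 (Direct M),
      WideAlu BitAnd 12 8 9, WideNot 11 9, WideAlu BitAnd 13 17 11, WideAlu BitOr 17 12 13] u2 u3"
      "wide_frame {11, 12, 13, 17} u2 u3" "wide u3 17 = G"
    by blast
  obtain u4 where u4: "exec w S (bit_cell_mask_code w (r * b) 17 9) u3 u4"
      "lanes w (wide u4 9) (lane_mask w (\<lambda>j. j < length (R i')))" "wide_frame {9, 10} u3 u4"
    using exec_bit_cell_mask_code[of w u3 b r 9 17 g S] u1(4) u2(3) u3(2,3) G const w_pos table_size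
    by (auto simp: g_iff wide_frame_def)
  have u4_17: "wide u4 17 = G" and u4_mem: "mem u4 = mem u"
    using u4(3) u3(2,3) u2(3) u1(2) by (simp_all add: wide_frame_def)
  define V where "V = alu (w * w) BitAnd (gather w (\<lambda>j. (M + block w G j) mod 2 ^ w) u) (wide u4 9)"
  have "lanes w V (\<lambda>j. if j < length (R i') then mem u ((M + g j) mod 2 ^ w) else 0)"
    unfolding V_def by (intro lanes_select w_pos u4(2) gather_lanes G mem)
  then have "lanes w V (\<lambda>j. if j < length (R i') then of_bool (\<beta> (R i' ! j)) else 0)"
  proof (rule lanes_cong)
    fix j
    show "(if j < length (R i') then mem u ((M + g j) mod 2 ^ w) else 0) =
        (if j < length (R i') then of_bool (\<beta> (R i' ! j)) else 0)"
    proof (cases "j < length (R i')")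
      case True
      then show ?thesis
        using g_bit[OF True] bit_index_less[OF i'(1) True] space stores_bit[OF stores] by simp
    qed simp
  qed
  note V = lanes_bits_of_register[OF i'(1) this]
  have "\<exists>z. exec w S [ReadContent 17 (Direct M), WideAlu BitAnd 17 17 9] u4 z \<and>
      wide_frame {17} u4 z \<and> wide z 17 = V"
    using u4_mem
    by (simp add: state_defs agree_outside_def wide_frame_def gather_def V_def u4_17 del: alu.simps)
  then obtain u5 where u5: "exec w S [ReadContent 17 (Direct M), WideAlu BitAnd 17 17 9] u4 u5"
      "wide_frame {17} u4 u5" "wide u5 17 = V"
    by blast
  let ?out = "[Compress 17 17, UW_Ordinary (Load (Suc K) (Direct M)), WriteBlock (Direct M) 17 (Direct 0),
      UW_Ordinary (Load x (Direct M)), UW_Ordinary (Store (Direct M) (Suc K))]"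
  \<comment> \<open>The borrowed word differs from its original contents in between, which is
    permitted only because it is one of the additional words.\<close>
  have "M \<in> S" using B_pos by simp
  then have "\<exists>z. exec w S ?out u5 z \<and> mem z = mem u5 \<and>
      (\<forall>y. y \<noteq> 17 \<longrightarrow> wide z y = wide u5 y) \<and>
      (\<forall>y<K. reg z y = (if y = x then read_bits (R i') \<beta> else reg u5 y))"
    using V x M_less w_pos
    by (auto simp: state_defs agree_outside_def u5(3) Let_def)
  then obtain u6 where u6: "exec w S ?out u5 u6" "mem u6 = mem u5"
      "\<And>y. y \<noteq> 17 \<Longrightarrow> wide u6 y = wide u5 y"
      "\<And>y. y < K \<Longrightarrow> reg u6 y = (if y = x then read_bits (R i') \<beta> else reg u5 y)"
    by blast
  have wide6: "wide u6 y = wide u y" if "y \<notin> {8, 9, 10, 11, 12, 13, 17}" for y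
    using that u6(3) u5(2) u4(3) u3(2) u2(3) u1(4) by (simp add: wide_frame_def)
  have "wide u6 0 = 0"
    using wide6[of 0] const[of 0] by (simp add: wide_const_def)
  from exec_clear_code[OF this] obtain u7 where u7: "exec w S clear_code u6 u7" "mem u7 = mem u6"
    "reg u7 = reg u6" "\<And>x. wide u7 x = (if 8 \<le> x \<and> x < 18 then 0 else wide u6 x)"
    by blast
  show thesis
  proof (rule that)
    show "exec w S (read_code K x i) u u7"
      unfolding read_code_def
      by (rule exec_appendI[OF u1(1) exec_appendI[OF u2(1) exec_appendI[OF u3(1)
            exec_appendI[OF u4(1) exec_appendI[OF u5(1) exec_appendI[OF u6(1) u7(1)]]]]]])
    show "mem u7 = mem u" using u7(2) u6(2) u5(2) u4_mem by (simp add: wide_frame_def)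
    show "reg u7 y = (if y = x then read_bits (R i') \<beta> else reg u y)" if "y < K" for y
      using that u7(3) u6(4) u5(2) u4(3) u3(2) u2(3) u1(3)[of y] by (simp add: wide_frame_def)
    show "wide u7 y = wide_const w b r y" if "y < 18" for y
    proof (cases "y < 8")
      case True
      then show ?thesis using u7(4) wide6[of y] const[of y] by simp
    next
      case False
      then show ?thesis using u7(4)[of y] that by (simp add: wide_const_def)
    qed
    show "wide u7 y = wide u y" if "18 \<le> y" for y
      using that u7(4) wide6[of y] by simp
  qed
qed

end

text \<open>Translation modulo N is injective on the numbers below N. So distinctness need only be
  checked for offsets, even where adding the base \<open>M\<close> wraps around.\<close>

lemma inj_on_add_mod:
  fixes M N :: nat
  assumes "inj_on f {..<w}" "\<And>j. j < w \<Longrightarrow> f j < N"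
  shows "inj_on (\<lambda>j. (M + f j) mod N) {..<w::nat}"
proof -
  have *: "(M + x) mod N = (if M mod N + x < N then M mod N + x else M mod N + x - N)" if "x < N" for x
  proof -
    have "M mod N < N" using that by simp
    then have "M mod N + x - N < N" using that by linarith
    then have "(M mod N + x) mod N = (if M mod N + x < N then M mod N + x else M mod N + x - N)"
      by (simp add: le_mod_geq)
    then show ?thesis by (simp add: mod_add_left_eq)
  qed
  have "f j = f j'" if "j < w" "j' < w" "(M + f j) mod N = (M + f j') mod N" for j j'
    using that(3) assms(2)[OF that(1)] assms(2)[OF that(2)]
    unfolding *[OF assms(2)[OF that(1)]] *[OF assms(2)[OF that(2)]]
    by (auto split: if_splits)
  then show ?thesis using assms(1) by (auto simp: inj_on_def)
qed

section \<open>Writing a register under the exclusive-write rule\<close>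

context fs_simulation
begin

text \<open>The value passes through the word at \<open>M\<close>, whose contents wait in
  \<open>Suc K\<close>. After the split, masks \<open>9\<close> and \<open>16\<close> select the
  active lanes with offsets in the lower and in the upper half; their rounds use the dummies in
  \<open>6\<close> and \<open>7\<close>, each from the opposite half.\<close>

definition write_code :: "nat \<Rightarrow> nat operand \<Rightarrow> nat \<Rightarrow> uw_code" where
  "write_code K i x =
     fetch_code K i @
     [UW_Ordinary (Load (Suc K) (Direct M)), UW_Ordinary (Store (Direct M) x),
      ReadBlock 14 (Direct 0) (Direct M), UW_Ordinary (Store (Direct M) (Suc K)), Spread 14 14] @
     bit_cell_mask_code w (r * b) 8 9 @ upper_mask_code 8 16 @
     [WideAlu BitAnd 16 16 9, WideNot 11 16, WideAlu BitAnd 9 9 11] @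
     masked_write_code M 9 6 @ masked_write_code M 16 7 @ clear_code"

lemma exec_write_code:
  assumes u: "ready \<beta> u" and i': "i' < r" "operand_val u i = i'" "set_operand i \<subseteq> {..<K}"
    and x: "x < K" "reg u x < 2 ^ w" and consistent: "write_consistent (R i') (reg u x)"
  obtains v where "exec w S (write_code K i x) u v"
    "stores (write_bits (R i') (reg u x) \<beta>) v" "\<And>a. a < M \<Longrightarrow> mem v a = mem u a"
    "\<And>a. a < 2 ^ w \<Longrightarrow> mem v a < 2 ^ w" "\<And>y. y < K \<Longrightarrow> reg v y = reg u y"
    "\<And>y. y < 18 \<Longrightarrow> wide v y = wide_const w b r y" "\<And>y. 18 \<le> y \<Longrightarrow> wide v y = wide u y"
proof -
  have const: "\<And>y. y < 18 \<Longrightarrow> wide u y = wide_const w b r y"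
    and mem: "\<And>a. a < 2 ^ w \<Longrightarrow> mem u a < 2 ^ w" and stores: "stores \<beta> u"
    using u by (auto simp: ready_def)
  let ?val = "reg u x" and ?half = "2 ^ (w - 1) :: nat"
  obtain u1 e where u1: "exec w S (fetch_code K i) u u1" "mem u1 = mem u"
    "\<And>y. y \<noteq> K \<Longrightarrow> reg u1 y = reg u y" "\<And>x. x \<noteq> 8 \<Longrightarrow> wide u1 x = wide u x"
    "lanes w (wide u1 8) e" and e: "\<And>j. j < b \<Longrightarrow> e j = entry (j * r + i')"
    by (rule exec_fetch_code[OF u i'(1,2), of K]) (use i'(3) in auto)
  have e_bit: "j < b \<and> r * b \<le> e j \<longleftrightarrow> active i' j" for j
    using e bit_cell_iff_active[OF i'(1)] length_le[OF i'(1)]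
    by (cases "j < b") (auto simp: active_def)
  have active_less: "j < b" if "active i' j" for j
    using that length_le[OF i'(1)] by (simp add: active_def)
  have e_active: "e j = r * b + R i' ! j" if "active i' j" for j
    using e[OF active_less[OF that]] entry_active[OF i'(1) that] by simp
  have R_less: "R i' ! j < B" if "active i' j" for j
    using that bit_index_less[OF i'(1)] by (simp add: active_def)
  have address: "(M + e j) mod 2 ^ w = M + (r * b + R i' ! j)" if "active i' j" for j
    using e_active[OF that] R_less[OF that] space by simp
  have e_less: "e j < 2 ^ w" if "j < w" for j
    using lanes_lane_less[OF u1(5) that] .
  let ?in = "[UW_Ordinary (Load (Suc K) (Direct M)), UW_Ordinary (Store (Direct M) x),
      ReadBlock 14 (Direct 0) (Direct M), UW_Ordinary (Store (Direct M) (Suc K)), Spread 14 14]"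
  have "wide u1 14 = 0" using u1(4)[of 14] const[of 14] by (simp add: wide_const_def)
  moreover have "block w 0 = (\<lambda>_. 0)" by (simp add: block_def fun_eq_iff)
  ultimately have "\<exists>z. exec w S ?in u1 z \<and> mem z = mem u \<and> (\<forall>y<K. reg z y = reg u1 y) \<and>
      (\<forall>y. y \<noteq> 14 \<longrightarrow> wide z y = wide u1 y) \<and> wide z 14 = spread w ?val"
    using x u1(2) u1(3)[of x] M_less w_pos B_pos of_blocks_first[OF w_pos, of ?val]
    by (auto simp: state_defs agree_outside_def Let_def)
  then obtain u2 where u2: "exec w S ?in u1 u2" "mem u2 = mem u"
      "\<And>y. y < K \<Longrightarrow> reg u2 y = reg u1 y" "\<And>y. y \<noteq> 14 \<Longrightarrow> wide u2 y = wide u1 y"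
      "wide u2 14 = spread w ?val"
    by blast
  have wide2: "wide u2 y = wide u y" if "y \<noteq> 8" "y \<noteq> 14" for y
    using that u2(4) u1(4) by simp
  have u2_8: "lanes w (wide u2 8) e" using u2(4) u1(5) by simp
  obtain u3 where u3: "exec w S (bit_cell_mask_code w (r * b) 8 9) u2 u3"
      "lanes w (wide u3 9) (lane_mask w (active i'))" "wide_frame {9, 10} u2 u3"
    using exec_bit_cell_mask_code[of w u2 b r 9 8 e S] wide2 const u2_8 w_pos table_size
    by (auto simp: e_bit)
  have u3_8: "lanes w (wide u3 8) e" using u3(3) u2_8 by (simp add: wide_frame_def)
  have u3_const: "wide u3 y = wide_const w b r y" if "y < 8" for y
    using that u3(3) wide2[of y] const[of y] by (simp add: wide_frame_def)
  obtain u4 where u4: "exec w S (upper_mask_code 8 16) u3 u4"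
      "lanes w (wide u4 16) (lane_mask w (\<lambda>j. j < b \<and> ?half \<le> e j))" "wide_frame {16, 10} u3 u4"
    using exec_upper_mask_code[of w u3 b r 16 8 e S] u3_const u3_8 w_pos by auto
  have u4_9: "lanes w (wide u4 9) (lane_mask w (active i'))"
    using u4(3) u3(2) by (simp add: wide_frame_def)
  \<comment> \<open>What counts is the half of the offset relative to \<open>M\<close>, not of the
    address: the cells of a half may straddle the middle of the memory or, for dummies, wrap
    around.\<close>
  define P1 where "P1 = (\<lambda>j. (j < b \<and> ?half \<le> e j) \<and> active i' j)"
  define P0 where "P0 = (\<lambda>j. active i' j \<and> \<not> P1 j)"
  let ?sel = "[WideAlu BitAnd 16 16 9, WideNot 11 16, WideAlu BitAnd 9 9 11]"
  define Q where "Q = alu (w * w) BitAnd (wide u4 16) (wide u4 9)"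
  have Q: "lanes w Q (lane_mask w P1)"
    unfolding Q_def P1_def by (intro lanes_mask_and w_pos u4(2) u4_9)
  have Q': "lanes w (alu (w * w) BitAnd (wide u4 9) (complement (w * w) Q)) (lane_mask w P0)"
    unfolding P0_def by (intro lanes_mask_and lanes_mask_not w_pos Q u4_9)
  have "\<exists>z. exec w S ?sel u4 z \<and> wide_frame {9, 11, 16} u4 z \<and> wide z 16 = Q \<and>
      wide z 9 = alu (w * w) BitAnd (wide u4 9) (complement (w * w) Q)"
    by (simp add: state_defs agree_outside_def wide_frame_def Q_def del: alu.simps)
  then obtain u5 where u5: "exec w S ?sel u4 u5" "wide_frame {9, 11, 16} u4 u5" "wide u5 16 = Q"
      "wide u5 9 = alu (w * w) BitAnd (wide u4 9) (complement (w * w) Q)"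
    by blast
  have mem5: "mem u5 = mem u" and reg5: "\<And>y. y < K \<Longrightarrow> reg u5 y = reg u y"
    using u5(2) u4(3) u3(3) u2(2,3) u1(3) by (simp_all add: wide_frame_def)
  have wide5: "wide u5 y = wide u y" if "y \<notin> {8, 9, 10, 11, 14, 16}" for y
    using that u5(2) u4(3) u3(3) wide2 by (simp add: wide_frame_def)
  have lanes5: "lanes w (wide u5 8) e" "lanes w (wide u5 14) (\<lambda>j. of_bool (bit ?val j))"
    using u5(2) u4(3) u3(3) u3_8 u2(5) spread_lanes[OF w_pos, of ?val] by (simp_all add: wide_frame_def)
  have lanes5': "lanes w (wide u5 6) (\<lambda>j. ?half + j)" "lanes w (wide u5 7) (\<lambda>j. j)"
    using wide5[of 6] wide5[of 7] const[of 6] const[of 7] lanes_const_6[OF w_pos, of b r]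
      lanes_const_7[OF w_pos, of b r] by simp_all
  have zero5: "wide u5 0 = 0" using wide5[of 0] const[of 0] by (simp add: wide_const_def)
  have P0: "e j < ?half" "active i' j" if "P0 j" for j
    using that active_less[of j] by (auto simp: P0_def P1_def)
  have P1: "?half \<le> e j" "active i' j" if "P1 j" for j
    using that by (auto simp: P1_def)
  have P_cases: "P0 j \<or> P1 j" if "active i' j" for j
    using that by (auto simp: P0_def)
  have e_inj: "j = j'" if "e j = e j'" "active i' j" "active i' j'" for j j'
    using that e_active active_inj[of i' j j'] by simp
  have addr_inj: "j = j'" if "(M + e j) mod 2 ^ w = (M + e j') mod 2 ^ w" "active i' j" "active i' j'" for j j'
    using that active_inj[of i' j j'] by (simp add: address)
  note half = half_double[OF w_pos]
  \<comment> \<open>Targets in \<open>P0\<close> have offsets below \<open>?half\<close>, dummies do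
    not, so collisions could only occur within one of the two groups. Activeness excludes them for
    targets, distinct lane numbers for dummies. \<open>inj1\<close> is the mirror image.\<close>
  have inj0: "inj_on (\<lambda>j. (M + (if P0 j then e j else ?half + j)) mod 2 ^ w) {..<w}"
  proof (rule inj_on_add_mod)
    show "inj_on (\<lambda>j. if P0 j then e j else ?half + j) {..<w}"
    proof (rule inj_onI)
      fix j j' assume "(if P0 j then e j else ?half + j) = (if P0 j' then e j' else ?half + j')"
      then show "j = j'"
        using P0(1)[of j] P0(1)[of j'] e_inj[of j j'] P0(2)[of j] P0(2)[of j']
        by (cases "P0 j"; cases "P0 j'") auto
    qed
    show "(if P0 j then e j else ?half + j) < 2 ^ w" if "j < w" for j
      using e_less[OF that] index_less_half[OF that] half by simp
  qed
  have inj1: "inj_on (\<lambda>j. (M + (if P1 j then e j else j)) mod 2 ^ w) {..<w}"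
  proof (rule inj_on_add_mod)
    show "inj_on (\<lambda>j. if P1 j then e j else j) {..<w}"
    proof (rule inj_onI)
      fix j j' assume "j \<in> {..<w}" "j' \<in> {..<w}" "(if P1 j then e j else j) = (if P1 j' then e j' else j')"
      then show "j = j'"
        using P1(1)[of j] P1(1)[of j'] e_inj[of j j'] P1(2)[of j] P1(2)[of j']
          index_less_half[of j w] index_less_half[of j' w]
        by (cases "P1 j"; cases "P1 j'") auto
    qed
    show "(if P1 j then e j else j) < 2 ^ w" if "j < w" for j
      using e_less[OF that] index_less_half[OF that] half by simp
  qed
  have in_S: "(M + e j) mod 2 ^ w \<in> S" if "active i' j" for j
    using address[OF that] R_less[OF that] by simp
  obtain u6 where u6: "exec w S (masked_write_code M 9 6) u5 u6" "reg u6 = reg u5"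
    "\<And>x. x \<notin> {11, 12, 13, 15} \<Longrightarrow> wide u6 x = wide u5 x"
    "\<And>j. j < w \<Longrightarrow> P0 j \<Longrightarrow> mem u6 ((M + e j) mod 2 ^ w) = of_bool (bit ?val j)"
    "\<And>c. (\<And>j. j < w \<Longrightarrow> P0 j \<Longrightarrow> c \<noteq> (M + e j) mod 2 ^ w) \<Longrightarrow> mem u6 c = mem u5 c"
  proof (rule exec_masked_write_code[OF w_pos _ _ zero5 _ lanes5 lanes5'(1) _ inj0, of 9])
    show "lanes w (wide u5 9) (lane_mask w P0)" using Q' u5(4) by simp
    show "mem u5 c < 2 ^ w" if "c < 2 ^ w" for c using mem that by (simp add: mem5)
    show "(M + e j) mod 2 ^ w \<in> S" if "P0 j" for j by (rule in_S[OF P0(2)[OF that]])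
  qed auto
  have two: "1 < (2::nat) ^ w" using w_pos by (rule one_less_power[rotated]) simp
  have mem6: "mem u6 c < 2 ^ w" if "c < 2 ^ w" for c
  proof (cases "\<exists>j<w. P0 j \<and> c = (M + e j) mod 2 ^ w")
    case True
    then show ?thesis using u6(4) two by auto
  next
    case False
    then have "mem u6 c = mem u5 c" by (intro u6(5)) auto
    then show ?thesis using mem[OF that] mem5 by simp
  qed
  have lanes6: "lanes w (wide u6 8) e" "lanes w (wide u6 14) (\<lambda>j. of_bool (bit ?val j))"
    "lanes w (wide u6 7) (\<lambda>j. j)" "lanes w (wide u6 16) (lane_mask w P1)" and zero6: "wide u6 0 = 0"
    using u6(3) lanes5 lanes5' zero5 Q u5(3) by simp_all
  obtain u7 where u7: "exec w S (masked_write_code M 16 7) u6 u7" "reg u7 = reg u6"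
    "\<And>x. x \<notin> {11, 12, 13, 15} \<Longrightarrow> wide u7 x = wide u6 x"
    "\<And>j. j < w \<Longrightarrow> P1 j \<Longrightarrow> mem u7 ((M + e j) mod 2 ^ w) = of_bool (bit ?val j)"
    "\<And>c. (\<And>j. j < w \<Longrightarrow> P1 j \<Longrightarrow> c \<noteq> (M + e j) mod 2 ^ w) \<Longrightarrow> mem u7 c = mem u6 c"
  proof (rule exec_masked_write_code[OF w_pos _ _ zero6 mem6 lanes6 inj1])
    show "(M + e j) mod 2 ^ w \<in> S" if "P1 j" for j by (rule in_S[OF P1(2)[OF that]])
  qed auto
  have written: "mem u7 (M + (r * b + R i' ! j)) = of_bool (bit ?val j)" if act: "active i' j" for j
  proof -
    have jw: "j < w" using active_less[OF act] b_le by simp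
    have "mem u7 ((M + e j) mod 2 ^ w) = of_bool (bit ?val j)"
    proof (cases "P1 j")
      case True
      then show ?thesis using u7(4) jw by simp
    next
      case False
      then have "P0 j" using P_cases[OF act] by simp
      \<comment> \<open>The cell is no target of the second round. A dummy of that round may hit it,
        but then it returns the value stored by the first round.\<close>
      have "mem u7 ((M + e j) mod 2 ^ w) = mem u6 ((M + e j) mod 2 ^ w)"
        using addr_inj act P1(2) False by (intro u7(5)) blast
      then show ?thesis using u6(4)[OF jw \<open>P0 j\<close>] by simp
    qed
    then show ?thesis by (simp add: address[OF act])
  qed
  have kept: "mem u7 c = mem u c" if c: "\<And>j. active i' j \<Longrightarrow> c \<noteq> M + (r * b + R i' ! j)" for c
  proof -
    have "mem u7 c = mem u6 c" using c P1(2) address by (intro u7(5)) metis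
    also have "\<dots> = mem u5 c" using c P0(2) address by (intro u6(5)) metis
    finally show ?thesis by (simp add: mem5)
  qed
  have wide7: "wide u7 y = wide u y" if "y \<notin> {8, 9, 10, 11, 12, 13, 14, 15, 16}" for y
    using that u7(3) u6(3) wide5 by simp
  have "wide u7 0 = 0" using wide7[of 0] const[of 0] by (simp add: wide_const_def)
  from exec_clear_code[OF this] obtain u8 where u8: "exec w S clear_code u7 u8" "mem u8 = mem u7"
    "reg u8 = reg u7" "\<And>x. wide u8 x = (if 8 \<le> x \<and> x < 18 then 0 else wide u7 x)"
    by blast
  show thesis
  proof (rule that)
    show "exec w S (write_code K i x) u u8"
      unfolding write_code_def
      by (rule exec_appendI[OF u1(1) exec_appendI[OF u2(1) exec_appendI[OF u3(1)
            exec_appendI[OF u4(1) exec_appendI[OF u5(1) exec_appendI[OF u6(1)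
            exec_appendI[OF u7(1) u8(1)]]]]]]])
    show "stores (write_bits (R i') ?val \<beta>) u8"
      unfolding stores_def u8(2)
    proof (intro allI impI)
      fix k assume k: "k < r * b + B"
      show "mem u7 (M + k) = cell_contents w r b R (write_bits (R i') ?val \<beta>) k"
      proof (cases "r * b \<le> k \<and> k - r * b \<in> set (R i')")
        case True
        then obtain j where j: "j < length (R i')" "R i' ! j = k - r * b" by (auto simp: in_set_conv_nth)
        let ?j = "first_index (R i') j"
        have j': "?j < length (R i')" "R i' ! ?j = k - r * b"
          using j first_index_le[of "R i'" j] by (simp_all add: nth_first_index)
        have "mem u7 (M + k) = of_bool (bit ?val ?j)"
          using written[of ?j] j' True by (simp add: active_def)
        \<comment> \<open>Consistency of the write makes all occurrences of a bit agree with the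
          first, the only one that is stored.\<close>
        moreover have "write_bits (R i') ?val \<beta> (k - r * b) \<longleftrightarrow> bit ?val ?j"
          using j' True consistent unfolding write_bits_def write_consistent_def by metis
        ultimately show ?thesis using True by (simp add: cell_contents_def)
      next
        case False
        have "mem u7 (M + k) = mem u (M + k)"
          using False by (intro kept) (auto simp: active_def)
        also have "\<dots> = cell_contents w r b R \<beta> k" using stores k by (simp add: stores_def)
        also have "\<dots> = cell_contents w r b R (write_bits (R i') ?val \<beta>) k"
          using False by (auto simp: cell_contents_def write_bits_def)
        finally show ?thesis .
      qed
    qed
    show "mem u8 a = mem u a" if "a < M" for a
      unfolding u8(2) using that by (intro kept) auto
    show "mem u8 a < 2 ^ w" if a: "a < 2 ^ w" for a
    proof (cases "\<exists>j. active i' j \<and> a = M + (r * b + R i' ! j)")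
      case True
      then show ?thesis unfolding u8(2) using written two by auto
    next
      case False
      then show ?thesis unfolding u8(2) using kept[of a] mem[OF a] by auto
    qed
    show "reg u8 y = reg u y" if "y < K" for y
      using that u8(3) u7(2) u6(2) reg5 by simp
    show "wide u8 y = wide_const w b r y" if "y < 18" for y
    proof (cases "y < 8")
      case True
      then show ?thesis using u8(4) wide7[of y] const[of y] by simp
    next
      case False
      then show ?thesis using u8(4)[of y] that by (simp add: wide_const_def)
    qed
    show "wide u8 y = wide u y" if "18 \<le> y" for y
      using that u8(4) wide7[of y] by simp
  qed
qed

end

section \<open>Simulation of FS-RAM programs\<close>

text \<open>Program counters can be equal between simulated instructions because instruction i is
  entered at position i in both programs. The word bounds keep every value that enters a lane from
  memory a proper word.\<close>

definition simulates ::
  "nat \<Rightarrow> nat \<Rightarrow> nat \<Rightarrow> nat \<Rightarrow> nat \<Rightarrow> ((nat \<Rightarrow> bool) \<Rightarrow> nat \<Rightarrow> nat) \<Rightarrow> (nat \<Rightarrow> nat) \<Rightarrow>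
   fs_state \<Rightarrow> uw_state \<Rightarrow> bool" where
  "simulates w K M n c enc wc s u \<longleftrightarrow>
     represents K M n c enc wc s u \<and> pc u = pc s \<and>
     (\<forall>x<K. reg u x < 2 ^ w) \<and> (\<forall>a<2 ^ w. mem u a < 2 ^ w)"

text \<open>A cost of at most c per simulated step adds up to c * T, and halting transfers because
  \<open>Halt\<close> stands at the same position in both programs.\<close>

lemma implements_if_simulates_step:
  assumes step: "\<And>s s' u. fs_step w M r R A s = Some s' \<Longrightarrow> simulates w K M n c enc wc s u \<Longrightarrow>
      \<exists>t u'. t \<le> c \<and> reaches w {..<M + n} P t u u' \<and> simulates w K M n c enc wc s' u'"
    and halt: "\<And>i. i < length A \<Longrightarrow> A ! i = FS_Ordinary Halt \<Longrightarrow> i < length P \<and> P ! i = UW_Ordinary Halt"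
  shows "implements w r R K M n c enc wc A P"
proof -
  have run: "\<exists>T' u'. T' \<le> c * T \<and> reaches w {..<M + n} P T' u u' \<and> simulates w K M n c enc wc s' u'"
    if "steps (fs_step w M r R A) T s = Some s'" "simulates w K M n c enc wc s u" for T s s' u
    using that
  proof (induction T arbitrary: s u)
    case 0
    then show ?case by (intro exI[of _ 0] exI[of _ u]) (simp add: reaches_0)
  next
    case (Suc T)
    then obtain s1 where s1: "fs_step w M r R A s = Some s1" "steps (fs_step w M r R A) T s1 = Some s'"
      by (auto simp: steps_Suc bind_eq_Some_conv)
    obtain t u1 where u1: "t \<le> c" "reaches w {..<M + n} P t u u1" "simulates w K M n c enc wc s1 u1"
      using step[OF s1(1) Suc.prems(2)] by blast
    obtain T' u' where u': "T' \<le> c * T" "reaches w {..<M + n} P T' u1 u'" "simulates w K M n c enc wc s' u'"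
      using Suc.IH[OF s1(2) u1(3)] by blast
    show ?case
      using reaches_trans[OF u1(2) u'(2)] u1(1) u'(1,3)
      by (intro exI[of _ "t + T'"] exI[of _ u']) simp
  qed
  show ?thesis
    unfolding implements_def
  proof (intro allI impI)
    fix s s' T u
    assume "pc s = 0" and R: "fs_run w M r R A T s s'" and "uw_valid w u" "pc u = 0"
      "represents K M n c enc wc s u"
    then have "simulates w K M n c enc wc s u" by (simp add: simulates_def uw_valid_def)
    with run[of T s s' u] R obtain T' u' where u': "T' \<le> c * T" "reaches w {..<M + n} P T' u u'"
        "simulates w K M n c enc wc s' u'"
      by (auto simp: fs_run_def)
    have "pc u' < length P \<and> P ! pc u' = UW_Ordinary Halt"
      using halt[of "pc s'"] R u'(3) by (auto simp: fs_run_def simulates_def)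
    then show "\<exists>u' T'. T' \<le> c * T \<and> uw_run w P T' u u' \<and> represents K M n c enc wc s' u' \<and>
        uw_writes_within w P T' u {..<M + n}"
      using u' by (intro exI[of _ u'] exI[of _ T']) (auto simp: uw_run_def reaches_def simulates_def)
  qed
qed

lemma alu_less:
  assumes "x < 2 ^ w" "y < 2 ^ w"
  shows "alu w f x y < 2 ^ w"
proof (cases f)
  case ShiftR
  then show ?thesis using assms(1) by (simp add: drop_bit_eq_div le_less_trans[OF div_le_dividend])
next
  case BitAnd
  then show ?thesis
    using assms by (auto simp: bit_and_iff intro!: nat_less_exp_if_bits dest: bit_less_exp_index)
next
  case BitOr
  then show ?thesis
    using assms by (auto simp: bit_or_iff intro!: nat_less_exp_if_bits dest: bit_less_exp_index)
qed simp_all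

lemma complement_less: "x < 2 ^ w \<Longrightarrow> complement w x < 2 ^ w"
  by (auto simp: complement_def bit_simps intro!: nat_less_exp_if_bits dest: bit_less_exp_index)

text \<open>A defined memory access of the FS-RAM lies below \<open>M\<close>, where the two
  memories agree. So the identical instruction can be executed, and it leaves the additional words
  alone.\<close>

lemma word_step_simulates:
  assumes "word_step w M I s = Some s'" "set_word_instr I \<subseteq> {..<K}" "M + n \<le> 2 ^ w"
    and sim: "simulates w K M n c enc wc s u"
  obtains u' where "word_step w (2 ^ w) I u = Some u'" "agree_outside w {..<M + n} u u'"
    "simulates w K M n c enc wc s' u'"
proof -
  have val: "operand_val u a = operand_val s a" if "set_operand a \<subseteq> {..<K}" for a
    using that sim by (cases a) (auto simp: simulates_def represents_def)
  have "\<exists>u'. word_step w (2 ^ w) I u = Some u' \<and> agree_outside w {..<M + n} u u' \<and>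
      simulates w K M n c enc wc s' u'"
  proof (cases I)
    case (Load x a)
    then show ?thesis
      using assms val[of a]
      by (auto simp: Let_def state_defs agree_outside_def simulates_def represents_def split: if_splits)
  next
    case (Store a x)
    then show ?thesis
      using assms val[of a]
      by (auto simp: Let_def state_defs agree_outside_def simulates_def represents_def split: if_splits)
  next
    case (Alu f x y z)
    then show ?thesis
      using assms
      by (auto simp: Let_def state_defs agree_outside_def simulates_def represents_def alu_less
          simp del: alu.simps)
  next
    case (BitNot x y)
    then show ?thesis
      using assms
      by (auto simp: state_defs agree_outside_def simulates_def represents_def complement_less)
  next
    case (Jump a)
    then show ?thesis
      using assms val[of a] by (auto simp: agree_outside_def simulates_def represents_def)
  next
    case (JumpIfZero x a)
    then show ?thesis
      using assms val[of a]
      by (auto simp: state_defs agree_outside_def simulates_def represents_def)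
  qed (use assms in \<open>auto simp: state_defs agree_outside_def simulates_def represents_def\<close>)
  then show thesis using that by blast
qed

section \<open>Layouts without bits\<close>

lemma no_bits_if_trivial:
  assumes "fs_layout r b B R" "b = 0 \<or> B = 0"
  shows "\<forall>i<r. R i = []"
  using assms by (auto simp: fs_layout_def)

text \<open>From an empty register a read yields 0, and a write to it does nothing, which a jump to
  the next instruction realises. One instruction each, without scratch space: the ordinary RAM may
  already exhaust the addresses.\<close>

lemma implements_trivial:
  assumes "0 < w" and empty: "\<forall>i<r. R i = []" and A: "fs_program K A" and n: "M + n \<le> 2 ^ w"
  defines "P \<equiv> map (\<lambda>i. UW_Ordinary (case A ! i of FS_Ordinary I \<Rightarrow> I | FS_Read x a \<Rightarrow> Const x 0
      | FS_Write a x \<Rightarrow> Jump (Direct (Suc i)))) [0..<length A]"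
  shows "uw_program (K + 100) 100 P" "length P \<le> 100 * length A"
    "implements w r R K M n 100 enc wc A P"
proof -
  have set_A: "set_fs_instr (A ! i) \<subseteq> {..<K}" if "i < length A" for i
    using A that by (simp add: fs_program_def)
  show "uw_program (K + 100) 100 P"
    unfolding uw_program_def P_def
    using set_A by (fastforce split: fs_instr.splits)
  show "length P \<le> 100 * length A" by (simp add: P_def)
  show "implements w r R K M n 100 enc wc A P"
  proof (rule implements_if_simulates_step)
    fix s s' u
    assume step: "fs_step w M r R A s = Some s'" and sim: "simulates w K M n 100 enc wc s u"
    then have pc: "pc s < length A" "pc u = pc s"
      by (auto simp: fs_step_def simulates_def split: if_splits)
    have exec: "fs_exec w M r R (A ! pc s) s = Some s'" using step pc by (simp add: fs_step_def)
    have "\<exists>u'. uw_step w P u = Some u' \<and> agree_outside w {..<M + n} u u' \<and> simulates w K M n 100 enc wc s' u'"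
    proof (cases "A ! pc s")
      case (FS_Ordinary I)
      then obtain u' where "word_step w (2 ^ w) I u = Some u'" "agree_outside w {..<M + n} u u'"
          "simulates w K M n 100 enc wc s' u'"
        using word_step_simulates[of w M I s s' K n 100 enc wc u] exec n sim set_A[OF pc(1)] by auto
      then show ?thesis using FS_Ordinary pc by (simp add: uw_step_def P_def)
    next
      case (FS_Read x a)
      then have "operand_val s a < r" using exec by (auto simp: Let_def split: if_splits)
      then show ?thesis
        using FS_Read pc sim exec empty[rule_format, of "operand_val s a"]
        by (auto simp: uw_step_def P_def state_defs read_bits_def agree_outside_def simulates_def represents_def)
    next
      case (FS_Write a x)
      then have "operand_val s a < r" using exec by (auto simp: Let_def split: if_splits)
      moreover have "write_bits [] v \<beta> = \<beta>" for v \<beta> by (simp add: write_bits_def fun_eq_iff)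
      ultimately have "s' = advance (s\<lparr>fs_bit := fs_bit s\<rparr>)"
        using FS_Write exec empty[rule_format, of "operand_val s a"] by (auto simp: Let_def split: if_splits)
      then show ?thesis
        using FS_Write pc sim
        by (auto simp: uw_step_def P_def state_defs agree_outside_def simulates_def represents_def)
    qed
    then obtain u' where u': "uw_step w P u = Some u'" "agree_outside w {..<M + n} u u'"
        "simulates w K M n 100 enc wc s' u'"
      by blast
    show "\<exists>t u'. t \<le> 100 \<and> reaches w {..<M + n} P t u u' \<and> simulates w K M n 100 enc wc s' u'"
      using reaches_Suc[OF u'(1,2) reaches_0] u'(3) by (intro exI[of _ "Suc 0"] exI[of _ u']) simp
  qed (simp add: P_def)
qed

section \<open>Program layout and the general case\<close>

context fs_simulation
begin

text \<open>
  Position \<open>i\<close> holds the code of instruction \<open>i\<close>, or a jump to it, so that direct and indirect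
  jump targets keep their meaning.
\<close>

definition body_code :: "nat \<Rightarrow> nat fs_instr \<Rightarrow> uw_code" where
  "body_code K I = (case I of FS_Read x i \<Rightarrow> read_code K x i | FS_Write i x \<Rightarrow> write_code K i x
     | FS_Ordinary _ \<Rightarrow> [])"

text \<open>Slots of equal size put slot i at \<open>length A + 60 * i\<close>. The longest body,
  that of a write, has 53 instructions, so the jump back fits; the padding ensures that the first 60
  entries exist.\<close>

definition slot :: "nat \<Rightarrow> nat fs_instr list \<Rightarrow> nat \<Rightarrow> uw_code" where
  "slot K A i = body_code K (A ! i) @ UW_Ordinary (Jump (Direct (Suc i))) # replicate 60 (UW_Ordinary Halt)"

definition program :: "nat \<Rightarrow> nat fs_instr list \<Rightarrow> uw_code" where
  "program K A =
     map (\<lambda>i. UW_Ordinary (case A ! i of FS_Ordinary I \<Rightarrow> I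
       | _ \<Rightarrow> Jump (Direct (length A + 60 * i)))) [0..<length A] @
     map (\<lambda>k. slot K A (k div 60) ! (k mod 60)) [0..<60 * length A]"

lemma length_body_code: "length (body_code K I) < 60"
  by (cases I)
     (simp_all add: body_code_def read_code_def write_code_def fetch_code_def bit_cell_mask_code_def
       upper_mask_code_def full_mask_code_def masked_write_code_def clear_code_def del: upt.simps
       split: operand.split)

lemma length_program: "length (program K A) = 61 * length A"
  by (simp add: program_def)

lemma nth_program_head:
  "i < length A \<Longrightarrow> program K A ! i = UW_Ordinary (case A ! i of FS_Ordinary I \<Rightarrow> I
     | _ \<Rightarrow> Jump (Direct (length A + 60 * i)))"
  by (simp add: program_def nth_append split: fs_instr.split)

lemma nth_program_slot:
  assumes "i < length A" "k < 60"
  shows "program K A ! (length A + 60 * i + k) = slot K A i ! k"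
proof -
  have "60 * i + k < 60 * length A" using assms by linarith
  moreover have "(60 * i + k) div 60 = i" "(60 * i + k) mod 60 = k" using assms(2) by simp_all
  ultimately show ?thesis by (simp add: program_def nth_append add.assoc)
qed

lemma registers_body_code:
  assumes "set_fs_instr I \<subseteq> {..<K}" "J \<in> set (body_code K I)"
  shows "set1_uw_instr J \<subseteq> {..<K + 100} \<and> set2_uw_instr J \<subseteq> {..<100}"
  using assms
  by (cases I)
     (auto simp: body_code_def read_code_def write_code_def fetch_code_def bit_cell_mask_code_def
       upper_mask_code_def full_mask_code_def masked_write_code_def clear_code_def
       split: operand.splits)

lemma uw_program_program:
  assumes "fs_program K A"
  shows "uw_program (K + 100) 100 (program K A)"
  unfolding uw_program_def
proof
  fix J assume "J \<in> set (program K A)"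
  then consider i where "i < length A" "J = UW_Ordinary (case A ! i of FS_Ordinary I \<Rightarrow> I
        | _ \<Rightarrow> Jump (Direct (length A + 60 * i)))"
    | k where "k < 60 * length A" "J = slot K A (k div 60) ! (k mod 60)"
    by (auto simp: program_def)
  then show "set1_uw_instr J \<subseteq> {..<K + 100} \<and> set2_uw_instr J \<subseteq> {..<100}"
  proof cases
    case 1
    have "set_fs_instr (A ! i) \<subseteq> {..<K}" using assms 1(1) by (simp add: fs_program_def)
    then show ?thesis using 1 by (auto split: fs_instr.splits)
  next
    case 2
    then have i: "k div 60 < length A" by (simp add: less_mult_imp_div_less mult.commute)
    have "J \<in> set (slot K A (k div 60))"
      unfolding 2(2) by (rule nth_mem) (simp add: slot_def less_trans[OF mod_less_divisor])
    then have "J \<in> set (body_code K (A ! (k div 60))) \<or> set1_uw_instr J = {} \<and> set2_uw_instr J = {}"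
      by (auto simp: slot_def)
    moreover have "set_fs_instr (A ! (k div 60)) \<subseteq> {..<K}" using assms i by (simp add: fs_program_def)
    ultimately show ?thesis using registers_body_code by blast
  qed
qed

text \<open>The jump into the slot, at most 59 instructions of the body and the jump back make at
  most 61 steps. The body starts from the state after the first jump, hence the shifted
  \<open>pc\<close>.\<close>

lemma reaches_body:
  assumes i: "pc u = i" "i < length A" and no_ord: "\<And>I. A ! i \<noteq> FS_Ordinary I"
    and exec: "exec w S (body_code K (A ! i)) (u\<lparr>pc := length A + 60 * i\<rparr>) v"
  obtains t where "t \<le> 100" "reaches w S (program K A) t u (v\<lparr>pc := Suc i\<rparr>)"
proof -
  let ?P = "program K A" and ?l = "length A + 60 * i" and ?code = "body_code K (A ! i)"
  let ?u = "u\<lparr>pc := ?l\<rparr>"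
  have bound: "?l + 60 \<le> length ?P" using i(2) by (simp add: length_program)
  have len: "length ?code < 60" by (rule length_body_code)
  have head: "?P ! i = UW_Ordinary (Jump (Direct ?l))"
    using nth_program_head[OF i(2), of K] no_ord by (cases "A ! i") auto
  have body: "reaches w S ?P (length ?code) ?u v"
  proof (rule exec_reaches[OF exec])
    fix k assume "k < length ?code"
    then show "?P ! (pc ?u + k) = ?code ! k"
      using nth_program_slot[OF i(2), of k K] len by (simp add: slot_def nth_append)
  qed (use bound len in simp)
  have pcv: "pc v = ?l + length ?code" using exec_pc[OF exec] by simp
  have "?P ! pc v = UW_Ordinary (Jump (Direct (Suc i)))"
    using nth_program_slot[OF i(2) len, of K] pcv by (simp add: slot_def nth_append)
  then have last: "uw_step w ?P v = Some (v\<lparr>pc := Suc i\<rparr>)"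
    using bound len pcv by (simp add: uw_step_def)
  have first: "uw_step w ?P u = Some ?u"
    using head i by (simp add: uw_step_def length_program)
  have "reaches w S ?P (Suc 0) v (v\<lparr>pc := Suc i\<rparr>)"
    by (rule reaches_Suc[OF last _ reaches_0]) (simp add: agree_outside_def)
  then have "reaches w S ?P (length ?code + Suc 0) ?u (v\<lparr>pc := Suc i\<rparr>)"
    by (rule reaches_trans[OF body])
  then have "reaches w S ?P (Suc (length ?code + Suc 0)) u (v\<lparr>pc := Suc i\<rparr>)"
    by (intro reaches_Suc[OF first]) (simp_all add: agree_outside_def)
  then show thesis using len by (intro that) auto
qed

lemma implements_program:
  assumes A: "fs_program K A"
  shows "implements w r R K M (r * b + B) 100 (cell_contents w r b R) (wide_const w b r) A (program K A)"
proof (rule implements_if_simulates_step)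
  let ?sim = "simulates w K M (r * b + B) 100 (cell_contents w r b R) (wide_const w b r)"
  fix s s' u
  assume step: "fs_step w M r R A s = Some s'" and sim: "?sim s u"
  then have pc: "pc s < length A" "pc u = pc s"
    by (auto simp: fs_step_def simulates_def split: if_splits)
  have exec: "fs_exec w M r R (A ! pc s) s = Some s'" using step pc by (simp add: fs_step_def)
  have regs: "set_fs_instr (A ! pc s) \<subseteq> {..<K}" using A pc by (simp add: fs_program_def)
  let ?u = "u\<lparr>pc := length A + 60 * pc s\<rparr>"
  have ready: "ready (fs_bit s) ?u"
    using sim by (auto simp: ready_def stores_def simulates_def represents_def)
  have val: "operand_val ?u a = operand_val s a" if "set_operand a \<subseteq> {..<K}" for a
    using that sim by (cases a) (auto simp: simulates_def represents_def)
  show "\<exists>t u'. t \<le> 100 \<and> reaches w S (program K A) t u u' \<and> ?sim s' u'"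
  proof (cases "A ! pc s")
    case (FS_Ordinary I)
    then obtain u' where u': "word_step w (2 ^ w) I u = Some u'" "agree_outside w S u u'" "?sim s' u'"
      using word_step_simulates[OF _ _ space sim, of I s'] exec regs by auto
    have "uw_step w (program K A) u = Some u'"
      using u'(1) pc nth_program_head[OF pc(1), of K] FS_Ordinary
      by (simp add: uw_step_def length_program)
    from reaches_Suc[OF this u'(2) reaches_0] show ?thesis
      using u'(3) by (intro exI[of _ "Suc 0"] exI[of _ u']) simp
  next
    case (FS_Read x a)
    let ?i = "operand_val s a"
    have i: "?i < r" and s': "s' = advance (set_reg x (read_bits (R ?i) (fs_bit s)) s)"
      using exec FS_Read by (auto simp: Let_def split: if_splits)
    have x: "x < K" and a: "set_operand a \<subseteq> {..<K}" using regs FS_Read by auto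
    obtain v where v: "exec w S (read_code K x a) ?u v" "mem v = mem ?u"
      "\<And>y. y < K \<Longrightarrow> reg v y = (if y = x then read_bits (R ?i) (fs_bit s) else reg ?u y)"
      "\<And>y. y < 18 \<Longrightarrow> wide v y = wide_const w b r y" "\<And>y. 18 \<le> y \<Longrightarrow> wide v y = wide ?u y"
      by (rule exec_read_code[OF ready i val[OF a] a x]) blast
    obtain t where t: "t \<le> 100" "reaches w S (program K A) t u (v\<lparr>pc := Suc (pc s)\<rparr>)"
      by (rule reaches_body[of u "pc s" A K v]) (use pc FS_Read v(1) in \<open>auto simp: body_code_def\<close>)
    have "read_bits (R ?i) (fs_bit s) < 2 ^ w"
      using length_le[OF i] b_le
      by (intro nat_less_exp_if_bits) (auto simp: read_bits_def bit_simps)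
    \<comment> \<open>\<open>represents\<close> speaks of 100 wide registers. Below 18 the constants
      have been restored; from 18 on the body changes nothing.\<close>
    moreover have "wide v y = wide_const w b r y" if "y < 100" for y
      using that v(4,5)[of y] sim by (cases "y < 18") (auto simp: simulates_def represents_def)
    ultimately have "?sim s' (v\<lparr>pc := Suc (pc s)\<rparr>)"
      using sim v(2,3) unfolding s' by (auto simp: simulates_def represents_def state_defs)
    then show ?thesis using t by blast
  next
    case (FS_Write a x)
    let ?i = "operand_val s a"
    have i: "?i < r" "write_consistent (R ?i) (reg s x)"
      and s': "s' = advance (s\<lparr>fs_bit := write_bits (R ?i) (reg s x) (fs_bit s)\<rparr>)"
      using exec FS_Write by (auto simp: Let_def split: if_splits)
    have x: "x < K" and a: "set_operand a \<subseteq> {..<K}" using regs FS_Write by auto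
    have ux: "reg ?u x = reg s x" "reg ?u x < 2 ^ w"
      using sim x by (auto simp: simulates_def represents_def)
    obtain v where v: "exec w S (write_code K a x) ?u v"
      "stores (write_bits (R ?i) (reg ?u x) (fs_bit s)) v" "\<And>c. c < M \<Longrightarrow> mem v c = mem ?u c"
      "\<And>c. c < 2 ^ w \<Longrightarrow> mem v c < 2 ^ w" "\<And>y. y < K \<Longrightarrow> reg v y = reg ?u y"
      "\<And>y. y < 18 \<Longrightarrow> wide v y = wide_const w b r y" "\<And>y. 18 \<le> y \<Longrightarrow> wide v y = wide ?u y"
      by (rule exec_write_code[OF ready i(1) val[OF a] a x ux(2)]) (use i(2) ux(1) in auto)
    obtain t where t: "t \<le> 100" "reaches w S (program K A) t u (v\<lparr>pc := Suc (pc s)\<rparr>)"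
      by (rule reaches_body[of u "pc s" A K v]) (use pc FS_Write v(1) in \<open>auto simp: body_code_def\<close>)
    have "wide v y = wide_const w b r y" if "y < 100" for y
      using that v(6,7)[of y] sim by (cases "y < 18") (auto simp: simulates_def represents_def)
    moreover have "mem v (M + k) = cell_contents w r b R (write_bits (R ?i) (reg s x) (fs_bit s)) k"
      if "k < r * b + B" for k
      using that v(2) unfolding ux(1) stores_def by blast
    ultimately have "?sim s' (v\<lparr>pc := Suc (pc s)\<rparr>)"
      using sim v(3-5) unfolding s' by (auto simp: simulates_def represents_def state_defs)
    then show ?thesis using t by blast
  qed
qed (simp add: length_program nth_program_head)

end

theorem theorem1:
  "\<exists>c::nat. \<forall>(w::nat) (b::nat) (r::nat) (B::nat) (R::layout).
     0 < w \<longrightarrow> fs_layout r b B R \<longrightarrow> b \<le> w \<longrightarrow> log 2 (real B) \<le> real w \<longrightarrow>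
     (\<exists>enc wc. encoding w (r * b + B) B c enc wc \<and>
        (\<forall>(K::nat) (M::nat) (A::nat fs_instr list).
           fs_program K A \<longrightarrow> M + (r * b + B) \<le> 2 ^ w \<longrightarrow>
           (\<exists>P. uw_program (K + c) c P \<and> length P \<le> c * length A \<and>
                implements w r R K M (r * b + B) c enc wc A P)))"
\<comment> \<open>A round number above everything it has to bound: 18 wide registers, two further
  ordinary registers, and 61 both as steps and as instructions per simulated instruction.\<close>
proof (intro exI[of _ 100] allI impI)
  fix w b r B :: nat and R :: layout
  assume w: "0 < w" and layout: "fs_layout r b B R" and b: "b \<le> w"
  let ?enc = "cell_contents w r b R" and ?wc = "wide_const w b r"
  have "\<exists>P. uw_program (K + 100) 100 P \<and> length P \<le> 100 * length A \<and>
      implements w r R K M (r * b + B) 100 ?enc ?wc A P"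
    if A: "fs_program K A" and space: "M + (r * b + B) \<le> 2 ^ w" for K M A
  proof (cases "0 < b \<and> 0 < B")
    case True
    then interpret fs_simulation w b r B M R
      using w layout b space by unfold_locales auto
    show ?thesis
      using uw_program_program[OF A] implements_program[OF A]
      by (intro exI[of _ "program K A"]) (simp add: length_program)
  next
    case False
    then have empty: "\<forall>i<r. R i = []" using no_bits_if_trivial[OF layout] by auto
    note trivial = implements_trivial[of w r R K A M "r * b + B", OF w empty A space]
    show ?thesis
      by (rule exI, intro conjI, rule trivial(1), rule trivial(2), rule trivial(3))
  qed
  then show "\<exists>enc wc. encoding w (r * b + B) B 100 enc wc \<and>
      (\<forall>K M A. fs_program K A \<longrightarrow> M + (r * b + B) \<le> 2 ^ w \<longrightarrow>
        (\<exists>P. uw_program (K + 100) 100 P \<and> length P \<le> 100 * length A \<and>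
          implements w r R K M (r * b + B) 100 enc wc A P))"
    using encoding_cell_contents[OF w, of r b B 100 R] by blast
qed

end
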